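(* Let $M$ be a 2-dimensional Riemannian manifold and let $x:M\to H^{3}$ (resp. $x:M\to S_1^{3}$) be an immersed surface (resp. space-like immersed surface) without umbilics. Then the normal Gauss map of $x(M)$ is conformal if and only if the Gauss curvature of $M$ satisfies $K=-1+\eta_3^2$ (resp. $K=1-\eta_3^2$).
   Context: Ambient spaces. Let $R_+^{3}=\{(x_1,x_2,x_3)\in\mathbb R^{3}: x_3>0\}$. $H^{3}$ is $R_+^{3}$ with the Riemannian metric $\frac{1}{x_3^2}(dx_1^2+dx_2^2+dx_3^2)$. $S_1^{3}$ (upper half-space model of de Sitter 3-space) is $R_+^{3}$ with the Lorentz metric $\frac{1}{x_3^2}(dx_1^2+dx_2^2-dx_3^2)$. Surfaces. $M$ carries the induced Riemannian metric $\mathrm I$, with Gauss (intrinsic) curvature $K$. The unit normal (resp. time-like unit normal) is $N=\sum_{A=1}^{3}x_3\eta_A\frac{\partial}{\partial x_A}$, with $\eta_1^2+\eta_2^2+\eta_3^2=1$ (resp. $\eta_1^2+\eta_2^2-\eta_3^2=-1$). The second fundamental form $\mathrm{II}$ is defined, with $D$ the ambient and $\nabla$ the induced Levi-Civita connection, by $D_XY=\nabla_XY+\mathrm{II}(X,Y)N$. An umbilic is a point at which $\mathrm{II}$ is a multiple of $\mathrm I$. Normal Gauss map. It is the map $\widetilde N=(\eta_1,\eta_2,\eta_3)$, with values in $S^2(1)\subset\mathbb R^3$ (resp. in $H^2(-1)\subset L^3$, where $L^3$ is $\mathbb R^3$ with the product $dx_1^2+dx_2^2-dx_3^2$). The fourth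 fundamental form is $\mathrm{IV}=\langle d\widetilde N,d\widetilde N\rangle$, with $\langle\cdot,\cdot\rangle$ the Euclidean metric of $\mathbb R^3$ (resp. the Lorentz-Minkowski metric of $L^3$). The normal Gauss map is called conformal if $\mathrm{IV}=\rho\,\mathrm{II}$ for some smooth function $\rho$ on $M$. *)

theory Defs
  imports "HOL-Analysis.Analysis"
begin

section \<open>Smooth surfaces\<close>

fun Ck_on :: "nat \<Rightarrow> (real^'n) set \<Rightarrow> (real^'n \<Rightarrow> 'b::real_normed_vector) \<Rightarrow> bool" where
  "Ck_on 0 S f \<longleftrightarrow> continuous_on S f"
| "Ck_on (Suc k) S f \<longleftrightarrow>
     f differentiable_on S \<and> (\<forall>v. Ck_on k S (\<lambda>p. frechet_derivative f (at p) v))"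

text \<open>Meaningful for open \<open>S\<close> only; this is the only way it is used below.\<close>

definition smooth_on :: "(real^'n) set \<Rightarrow> (real^'n \<Rightarrow> 'b::real_normed_vector) \<Rightarrow> bool" where
  "smooth_on S f \<longleftrightarrow> (\<forall>k. Ck_on k S f)"

type_synonym 'a chart = "'a set \<times> ('a \<Rightarrow> real^2)"

definition chart_image :: "'a chart \<Rightarrow> (real^2) set" where
  "chart_image c = snd c ` fst c"

definition local_rep :: "'a chart \<Rightarrow> ('a \<Rightarrow> 'b) \<Rightarrow> real^2 \<Rightarrow> 'b" where
  "local_rep c f = f \<circ> inv_into (fst c) (snd c)"

text \<open>A 2-dimensional smooth manifold (without boundary): the underlying space \<open>T\<close> together with
  a smooth atlas \<open>A\<close>, which need not be maximal.\<close>

definition smooth_surface :: "'a topology \<Rightarrow> 'a chart set \<Rightarrow> bool" where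
  "smooth_surface T A \<longleftrightarrow>
     Hausdorff_space T \<and>
     (\<exists>\<B>. countable \<B> \<and> openin T = arbitrary union_of (\<lambda>U. U \<in> \<B>)) \<and>
     (\<Union>c\<in>A. fst c) = topspace T \<and>
     (\<forall>c\<in>A. openin T (fst c) \<and> open (chart_image c) \<and>
        homeomorphic_map (subtopology T (fst c)) (top_of_set (chart_image c)) (snd c)) \<and>
     (\<forall>c\<in>A. \<forall>d\<in>A. smooth_on (snd c ` (fst c \<inter> fst d)) (local_rep c (snd d)))"

definition smooth_map :: "'a chart set \<Rightarrow> ('a \<Rightarrow> 'b::real_normed_vector) \<Rightarrow> bool" where
  "smooth_map A f \<longleftrightarrow> (\<forall>c\<in>A. smooth_on (chart_image c) (local_rep c f))"

section \<open>Metrics in coordinates\<close>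

text \<open>A (semi-Riemannian) metric on an open subset of \<open>real^'n\<close> is given by its Gram matrix
  with respect to the coordinate vector fields.\<close>

definition pairing :: "real^'n^'n \<Rightarrow> real^'n \<Rightarrow> real^'n \<Rightarrow> real" where
  "pairing G v w = v \<bullet> (G *v w)"

definition partial :: "'n \<Rightarrow> (real^'n \<Rightarrow> 'b::real_normed_vector) \<Rightarrow> real^'n \<Rightarrow> 'b" where
  "partial i f p = frechet_derivative f (at p) (axis i 1)"

text \<open>\<open>christoffel G p k i j\<close> is the coefficient of the \<open>k\<close>-th coordinate field in the Levi-Civita
  derivative of the \<open>j\<close>-th coordinate field along the \<open>i\<close>-th.\<close>

definition christoffel :: "(real^'n \<Rightarrow> real^'n^'n) \<Rightarrow> real^'n \<Rightarrow> 'n \<Rightarrow> 'n \<Rightarrow> 'n \<Rightarrow> real" where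
  "christoffel G p k i j =
     (\<Sum>l\<in>UNIV. matrix_inv (G p) $ k $ l *
        (partial i (\<lambda>q. G q $ l $ j) p + partial j (\<lambda>q. G q $ l $ i) p
         - partial l (\<lambda>q. G q $ i $ j) p)) / 2"

text \<open>\<open>riemann G p l k i j\<close> is the \<open>l\<close>-th component of
  \<open>R(\<partial>\<^sub>i, \<partial>\<^sub>j) \<partial>\<^sub>k = \<nabla>\<^sub>i \<nabla>\<^sub>j \<partial>\<^sub>k - \<nabla>\<^sub>j \<nabla>\<^sub>i \<partial>\<^sub>k\<close>.\<close>

definition riemann :: "(real^'n \<Rightarrow> real^'n^'n) \<Rightarrow> real^'n \<Rightarrow> 'n \<Rightarrow> 'n \<Rightarrow> 'n \<Rightarrow> 'n \<Rightarrow> real" where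
  "riemann G p l k i j =
     partial i (\<lambda>q. christoffel G q l j k) p - partial j (\<lambda>q. christoffel G q l i k) p
     + (\<Sum>m\<in>UNIV. christoffel G p l i m * christoffel G p m j k
                 - christoffel G p l j m * christoffel G p m i k)"

definition curvature :: "(real^2 \<Rightarrow> real^2^2) \<Rightarrow> real^2 \<Rightarrow> real" where
  "curvature G p = (\<Sum>l\<in>UNIV. G p $ 1 $ l * riemann G p l 2 1 2) / det (G p)"

section \<open>The ambient spaces\<close>

definition half_space :: "(real^3) set" where
  "half_space = {y. y $ 3 > 0}"

abbreviation euclidean_form :: "real^3^3" where
  "euclidean_form \<equiv> mat 1"

definition minkowski_form :: "real^3^3" where
  "minkowski_form = (\<chi> i j. if i \<noteq> j then 0 else if i = 3 then -1 else 1)"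

text \<open>For \<open>J = euclidean_form\<close> this is the metric of hyperbolic 3-space, for \<open>J = minkowski_form\<close> that of
  the upper half-space model of de Sitter 3-space.\<close>

definition half_space_metric :: "real^3^3 \<Rightarrow> real^3 \<Rightarrow> real^3^3" where
  "half_space_metric J y = (1 / (y $ 3)\<^sup>2) *\<^sub>R J"

section \<open>Immersed surfaces\<close>

text \<open>Bilinear forms on the surface are given, in each chart \<open>c\<close>, by their Gram matrices
  with respect to the coordinate fields, as functions on \<open>chart_image c\<close>. Throughout, \<open>x\<close> is the
  immersion, \<open>N\<close> the unit normal field (by its components in \<open>real^3\<close>), and \<open>J\<close> selects the ambient
  metric.\<close>

definition first_form :: "real^3^3 \<Rightarrow> ('a \<Rightarrow> real^3) \<Rightarrow> 'a chart \<Rightarrow> real^2 \<Rightarrow> real^2^2" where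
  "first_form J x c u =
     (\<chi> i j. pairing (half_space_metric J (local_rep c x u))
               (partial i (local_rep c x) u) (partial j (local_rep c x) u))"

definition immersed_surface :: "'a chart set \<Rightarrow> ('a \<Rightarrow> real^3) \<Rightarrow> bool" where
  "immersed_surface A x \<longleftrightarrow>
     smooth_map A x \<and> (\<forall>c\<in>A. x ` fst c \<subseteq> half_space) \<and>
     (\<forall>c\<in>A. \<forall>u\<in>chart_image c. inj (frechet_derivative (local_rep c x) (at u)))"

definition space_like :: "real^3^3 \<Rightarrow> 'a chart set \<Rightarrow> ('a \<Rightarrow> real^3) \<Rightarrow> bool" where
  "space_like J A x \<longleftrightarrow>
     (\<forall>c\<in>A. \<forall>u\<in>chart_image c. \<forall>v. v \<noteq> 0 \<longrightarrow> pairing (first_form J x c u) v v > 0)"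

text \<open>\<open>e\<close> is the value of \<open>\<langle>N, N\<rangle>\<close>: \<open>1\<close> in hyperbolic space, \<open>-1\<close> (time-like) in de Sitter space.\<close>

definition unit_normal ::
    "real^3^3 \<Rightarrow> real \<Rightarrow> 'a chart set \<Rightarrow> ('a \<Rightarrow> real^3) \<Rightarrow> ('a \<Rightarrow> real^3) \<Rightarrow> bool" where
  "unit_normal J e A x N \<longleftrightarrow>
     smooth_map A N \<and>
     (\<forall>c\<in>A. \<forall>p\<in>fst c.
        pairing (half_space_metric J (x p)) (N p) (N p) = e \<and>
        (\<forall>i. pairing (half_space_metric J (x p)) (N p) (partial i (local_rep c x) (snd c p)) = 0))"

text \<open>The ambient derivative \<open>D\<close> of the \<open>j\<close>-th coordinate field of the surface along the \<open>i\<close>-th,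
  its induced derivative \<open>\<nabla>\<close> (pushed forward by \<open>x\<close>), and the second fundamental form,
  determined by \<open>D\<^sub>i \<partial>\<^sub>j = \<nabla>\<^sub>i \<partial>\<^sub>j + II(\<partial>\<^sub>i, \<partial>\<^sub>j) N\<close>.\<close>

definition ambient_deriv ::
    "real^3^3 \<Rightarrow> ('a \<Rightarrow> real^3) \<Rightarrow> 'a chart \<Rightarrow> real^2 \<Rightarrow> 2 \<Rightarrow> 2 \<Rightarrow> real^3" where
  "ambient_deriv J x c u i j =
     partial i (partial j (local_rep c x)) u +
     (\<chi> k. \<Sum>l\<in>UNIV. \<Sum>m\<in>UNIV. christoffel (half_space_metric J) (local_rep c x u) k l m *
        partial i (local_rep c x) u $ l * partial j (local_rep c x) u $ m)"

definition induced_deriv ::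
    "real^3^3 \<Rightarrow> ('a \<Rightarrow> real^3) \<Rightarrow> 'a chart \<Rightarrow> real^2 \<Rightarrow> 2 \<Rightarrow> 2 \<Rightarrow> real^3" where
  "induced_deriv J x c u i j =
     (\<Sum>k\<in>UNIV. christoffel (first_form J x c) u k i j *\<^sub>R partial k (local_rep c x) u)"

definition second_form ::
    "real^3^3 \<Rightarrow> ('a \<Rightarrow> real^3) \<Rightarrow> ('a \<Rightarrow> real^3) \<Rightarrow> 'a chart \<Rightarrow> real^2 \<Rightarrow> real^2^2" where
  "second_form J x N c u =
     (\<chi> i j. THE h. ambient_deriv J x c u i j = induced_deriv J x c u i j + h *\<^sub>R local_rep c N u)"

definition umbilic ::
    "real^3^3 \<Rightarrow> 'a chart set \<Rightarrow> ('a \<Rightarrow> real^3) \<Rightarrow> ('a \<Rightarrow> real^3) \<Rightarrow> 'a \<Rightarrow> bool" where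
  "umbilic J A x N p \<longleftrightarrow>
     (\<exists>a. \<forall>c\<in>A. p \<in> fst c \<longrightarrow>
        second_form J x N c (snd c p) = a *\<^sub>R first_form J x c (snd c p))"

definition gauss_curvature ::
    "real^3^3 \<Rightarrow> ('a \<Rightarrow> real^3) \<Rightarrow> 'a chart \<Rightarrow> 'a \<Rightarrow> real" where
  "gauss_curvature J x c p = curvature (first_form J x c) (snd c p)"

text \<open>The normal Gauss map consists of the \<open>\<eta>\<^sub>k\<close> in \<open>N = (\<Sum>k. x\<^sub>3 \<eta>\<^sub>k \<partial>/\<partial>x\<^sub>k)\<close>.\<close>

definition normal_gauss_map :: "('a \<Rightarrow> real^3) \<Rightarrow> ('a \<Rightarrow> real^3) \<Rightarrow> 'a \<Rightarrow> real^3" where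
  "normal_gauss_map x N p = (1 / x p $ 3) *\<^sub>R N p"

definition fourth_form ::
    "real^3^3 \<Rightarrow> ('a \<Rightarrow> real^3) \<Rightarrow> ('a \<Rightarrow> real^3) \<Rightarrow> 'a chart \<Rightarrow> real^2 \<Rightarrow> real^2^2" where
  "fourth_form J x N c u =
     (\<chi> i j. pairing J (partial i (local_rep c (normal_gauss_map x N)) u)
                       (partial j (local_rep c (normal_gauss_map x N)) u))"

definition conformal_normal_gauss_map ::
    "real^3^3 \<Rightarrow> 'a chart set \<Rightarrow> ('a \<Rightarrow> real^3) \<Rightarrow> ('a \<Rightarrow> real^3) \<Rightarrow> bool" where
  "conformal_normal_gauss_map J A x N \<longleftrightarrow>
     (\<exists>\<rho> :: 'a \<Rightarrow> real. smooth_map A \<rho> \<and>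
        (\<forall>c\<in>A. \<forall>p\<in>fst c.
           fourth_form J x N c (snd c p) = \<rho> p *\<^sub>R second_form J x N c (snd c p)))"

end

theory Submission
  imports Defs
begin

text \<open>Write \<open>J = diag(1, 1, e)\<close> with \<open>e = 1\<close> (hyperbolic) or \<open>e = -1\<close> (de Sitter), so that \<open>N\<close> has square \<open>e\<close>
  and the ambient space has constant curvature \<open>-e\<close>. As the ambient metric is \<open>J / x\<^sub>3\<^sup>2\<close>, the second form is
  \<open>II = e (\<eta>\<^sub>3 I - b)\<close> with \<open>b = J(dx, d\<eta>) / x\<^sub>3\<close>, and \<open>IV = b I\<^sup>-\<^sup>1 b\<close>. Cayley-Hamilton for \<open>I\<^sup>-\<^sup>1 b\<close> makes \<open>IV\<close> a
  combination of \<open>b\<close> and \<open>I\<close>, hence of \<open>II\<close> and \<open>I\<close>; by the Gauss equation \<open>K = -e + e det II / det I\<close> the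
  coefficient of \<open>I\<close> is \<open>- e (K - (- e + e \<eta>\<^sub>3\<^sup>2))\<close>. Without umbilics \<open>I\<close> and \<open>II\<close> are linearly
  independent, so \<open>IV\<close> is a multiple of \<open>II\<close> exactly where this coefficient vanishes, and the factor is then
  a smooth function of the coefficients of \<open>I\<close>, \<open>II\<close> and of \<open>\<eta>\<^sub>3\<close>.\<close>

section \<open>Smooth functions and partial derivatives\<close>

lemma Ck_on_cong:
  fixes f g :: "real^'n \<Rightarrow> 'b::real_normed_vector"
  assumes "open S" "\<And>p. p \<in> S \<Longrightarrow> f p = g p" "Ck_on k S f"
  shows "Ck_on k S g"
  using assms(2,3)
proof (induction k arbitrary: f g)
  case 0
  then show ?case by (simp cong: continuous_on_cong)
next
  case (Suc k)
  have f: "f differentiable (at p)" if "p \<in> S" for p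
    using Suc.prems(2) assms(1) that by (simp add: differentiable_on_eq_differentiable_at)
  have eq: "frechet_derivative f (at p) = frechet_derivative g (at p)" if "p \<in> S" for p
    using frechet_derivative_transform_within_open[OF f[OF that] assms(1) that] Suc.prems(1) by blast
  have "g differentiable_on S"
    using f eq Suc.prems(1) has_derivative_transform_within_open[OF frechet_derivative_works[THEN iffD1, OF f] assms(1)]
    by (metis assms(1) differentiableI differentiable_on_eq_differentiable_at)
  moreover have "Ck_on k S (\<lambda>p. frechet_derivative g (at p) v)" for v
    by (rule Suc.IH[where f = "\<lambda>p. frechet_derivative f (at p) v"]) (use Suc.prems eq in auto)
  ultimately show ?case by simp
qed

lemma Ck_on_Suc_imp: "Ck_on (Suc k) S f \<Longrightarrow> Ck_on k S f"
proof (induction k arbitrary: f)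
  case 0
  then show ?case by (auto intro: differentiable_imp_continuous_on)
next
  case (Suc k)
  have "f differentiable_on S" and "Ck_on (Suc k) S (\<lambda>p. frechet_derivative f (at p) v)" for v
    using Suc.prems by (subst (asm) Ck_on.simps, blast)+
  then show ?case
    using Suc.IH by (subst Ck_on.simps) blast
qed

lemma Ck_on_SucI:
  fixes f :: "real^'n \<Rightarrow> 'b::real_normed_vector"
  assumes "open S" "\<And>p. p \<in> S \<Longrightarrow> (f has_derivative f' p) (at p)"
    "\<And>v. Ck_on k S (\<lambda>p. f' p v)"
  shows "Ck_on (Suc k) S f"
proof -
  have "f differentiable_on S"
    using assms(1,2) differentiableI by (auto simp: differentiable_on_eq_differentiable_at)
  moreover have "Ck_on k S (\<lambda>p. frechet_derivative f (at p) v)" for v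
    by (rule Ck_on_cong[OF assms(1) _ assms(3)[of v]]) (simp add: frechet_derivative_at[OF assms(2)])
  ultimately show ?thesis by simp
qed

lemma Ck_on_has_derivative:
  assumes "open S" "Ck_on (Suc k) S f" "p \<in> S"
  shows "(f has_derivative frechet_derivative f (at p)) (at p)"
  using assms frechet_derivative_works[of f "at p"] by (simp add: differentiable_on_eq_differentiable_at)

lemma Ck_on_const: "Ck_on k S (\<lambda>p. c)"
  by (induction k arbitrary: c) (simp_all add: differentiable_on_const)

lemma Ck_on_bounded_linear:
  assumes "open S" "bounded_linear L" "Ck_on k S f"
  shows "Ck_on k S (\<lambda>p. L (f p))"
  using assms(3)
proof (induction k arbitrary: f)
  case 0
  then show ?case using assms(2) by (simp add: bounded_linear.continuous_on)
next
  case (Suc k)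
  show ?case
    by (rule Ck_on_SucI[OF assms(1),
          OF bounded_linear.has_derivative[OF assms(2) Ck_on_has_derivative]])
      (use Suc assms(1) in auto)
qed

lemma Ck_on_add:
  assumes "open S" "Ck_on k S f" "Ck_on k S g"
  shows "Ck_on k S (\<lambda>p. f p + g p)"
  using assms(2,3)
proof (induction k arbitrary: f g)
  case 0
  then show ?case by (simp add: continuous_on_add)
next
  case (Suc k)
  show ?case
    by (rule Ck_on_SucI[OF assms(1), OF has_derivative_add[OF Ck_on_has_derivative Ck_on_has_derivative]])
      (use Suc assms(1) in auto)
qed

lemma Ck_on_bilinear:
  assumes "open S" "bounded_bilinear B" "Ck_on k S f" "Ck_on k S g"
  shows "Ck_on k S (\<lambda>p. B (f p) (g p))"
  using assms(3,4)
proof (induction k arbitrary: f g)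
  case 0
  then show ?case using assms(2) by (simp add: bounded_bilinear.continuous_on)
next
  case (Suc k)
  note low = Suc.prems[THEN Ck_on_Suc_imp]
  show ?case
    by (rule Ck_on_SucI[OF assms(1),
          OF bounded_bilinear.FDERIV[OF assms(2) Ck_on_has_derivative Ck_on_has_derivative]])
      (use Suc low assms(1) in \<open>auto intro!: Ck_on_add\<close>)
qed

lemma Ck_on_inverse:
  fixes f :: "real^'n \<Rightarrow> real"
  assumes "open S" "\<And>p. p \<in> S \<Longrightarrow> f p \<noteq> 0" "Ck_on k S f"
  shows "Ck_on k S (\<lambda>p. inverse (f p))"
  using assms(3)
proof (induction k)
  case 0
  then show ?case using assms(2) by (simp add: continuous_on_inverse)
next
  case (Suc k)
  show ?case
  proof (rule Ck_on_SucI[OF assms(1)])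
    fix p assume "p \<in> S"
    then show "((\<lambda>p. inverse (f p)) has_derivative
        (\<lambda>v. - (inverse (f p) * frechet_derivative f (at p) v * inverse (f p)))) (at p)"
      using Deriv.has_derivative_inverse[OF assms(2) Ck_on_has_derivative[OF assms(1) Suc.prems]] by blast
  next
    fix v
    show "Ck_on k S (\<lambda>p. - (inverse (f p) * frechet_derivative f (at p) v * inverse (f p)))"
      using Suc.prems Suc.IH[OF Ck_on_Suc_imp[OF Suc.prems]]
      by (intro Ck_on_bounded_linear[OF assms(1) bounded_linear_minus[OF bounded_linear_ident]]
          Ck_on_bilinear[OF assms(1) bounded_bilinear_mult]) auto
  qed
qed

lemma smooth_on_cong:
  fixes f g :: "real^'n \<Rightarrow> 'b::real_normed_vector"
  assumes "smooth_on S f" "open S" "\<And>p. p \<in> S \<Longrightarrow> f p = g p"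
  shows "smooth_on S g"
  using assms Ck_on_cong unfolding smooth_on_def by blast

lemma smooth_on_has_derivative:
  assumes "smooth_on S f" "open S" "p \<in> S"
  shows "(f has_derivative frechet_derivative f (at p)) (at p)"
  using assms Ck_on_has_derivative unfolding smooth_on_def by blast

lemma smooth_on_differentiable:
  "smooth_on S f \<Longrightarrow> open S \<Longrightarrow> p \<in> S \<Longrightarrow> f differentiable (at p)"
  by (meson differentiableI smooth_on_has_derivative)

lemma smooth_on_frechet_derivative:
  "smooth_on S f \<Longrightarrow> smooth_on S (\<lambda>p. frechet_derivative f (at p) v)"
  unfolding smooth_on_def by (metis Ck_on.simps(2))

lemma smooth_on_partial: "smooth_on S f \<Longrightarrow> smooth_on S (partial i f)"
  unfolding partial_def by (rule smooth_on_frechet_derivative)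

lemma smooth_on_const: "smooth_on S (\<lambda>p. c)"
  by (simp add: smooth_on_def Ck_on_const)

lemma smooth_on_bounded_linear:
  "smooth_on S f \<Longrightarrow> open S \<Longrightarrow> bounded_linear L \<Longrightarrow> smooth_on S (\<lambda>p. L (f p))"
  by (simp add: smooth_on_def Ck_on_bounded_linear)

lemma smooth_on_add:
  "smooth_on S f \<Longrightarrow> smooth_on S g \<Longrightarrow> open S \<Longrightarrow> smooth_on S (\<lambda>p. f p + g p)"
  by (simp add: smooth_on_def Ck_on_add)

lemma smooth_on_minus: "smooth_on S f \<Longrightarrow> open S \<Longrightarrow> smooth_on S (\<lambda>p. - f p)"
  by (rule smooth_on_bounded_linear[OF _ _ bounded_linear_minus[OF bounded_linear_ident]])

lemma smooth_on_diff:
  "smooth_on S f \<Longrightarrow> smooth_on S g \<Longrightarrow> open S \<Longrightarrow> smooth_on S (\<lambda>p. f p - g p)"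
  using smooth_on_add[OF _ smooth_on_minus] by fastforce

lemma smooth_on_scaleR:
  "smooth_on S f \<Longrightarrow> smooth_on S g \<Longrightarrow> open S \<Longrightarrow> smooth_on S (\<lambda>p. f p *\<^sub>R g p)"
  by (simp add: smooth_on_def Ck_on_bilinear[OF _ bounded_bilinear_scaleR])

lemma smooth_on_mult:
  fixes f g :: "real^'n \<Rightarrow> real"
  shows "smooth_on S f \<Longrightarrow> smooth_on S g \<Longrightarrow> open S \<Longrightarrow> smooth_on S (\<lambda>p. f p * g p)"
  by (simp add: smooth_on_def Ck_on_bilinear[OF _ bounded_bilinear_mult])

lemma smooth_on_power:
  fixes f :: "real^'n \<Rightarrow> real"
  shows "smooth_on S f \<Longrightarrow> open S \<Longrightarrow> smooth_on S (\<lambda>p. f p ^ m)"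
  by (induction m) (simp_all add: smooth_on_const smooth_on_mult)

lemma smooth_on_divide:
  fixes f g :: "real^'n \<Rightarrow> real"
  assumes "smooth_on S f" "smooth_on S g" "open S" "\<And>p. p \<in> S \<Longrightarrow> g p \<noteq> 0"
  shows "smooth_on S (\<lambda>p. f p / g p)"
proof -
  have "smooth_on S (\<lambda>p. inverse (g p))"
    using assms by (simp add: smooth_on_def Ck_on_inverse)
  then show ?thesis
    using smooth_on_mult[OF assms(1) _ assms(3)] by (simp add: divide_inverse)
qed

lemma smooth_on_component:
  fixes f :: "real^'n \<Rightarrow> real^'m"
  shows "smooth_on S f \<Longrightarrow> open S \<Longrightarrow> smooth_on S (\<lambda>p. f p $ k)"
  by (rule smooth_on_bounded_linear[OF _ _ bounded_linear_vec_nth])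

lemma smooth_on_sum:
  "finite F \<Longrightarrow> (\<And>l. l \<in> F \<Longrightarrow> smooth_on S (f l)) \<Longrightarrow> open S \<Longrightarrow> smooth_on S (\<lambda>p. \<Sum>l\<in>F. f l p)"
  by (induction F rule: finite_induct) (simp_all add: smooth_on_const smooth_on_add)

lemma partial_eqI: "(f has_derivative f') (at p) \<Longrightarrow> partial i f p = f' (axis i 1)"
  by (simp add: partial_def flip: frechet_derivative_at)

lemma has_derivative_partial:
  "f differentiable (at p) \<Longrightarrow> (f has_derivative frechet_derivative f (at p)) (at p)"
  by (simp add: frechet_derivative_works[symmetric])

lemma partial_const: "partial i (\<lambda>p. c) p = 0"
  by (simp add: partial_def)

lemma partial_bounded_linear:
  assumes "bounded_linear L" "f differentiable (at p)"
  shows "partial i (\<lambda>q. L (f q)) p = L (partial i f p)"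
  using partial_eqI[OF bounded_linear.has_derivative[OF assms(1) has_derivative_partial[OF assms(2)]]]
  by (simp add: partial_def)

lemma partial_component:
  fixes f :: "real^'n \<Rightarrow> real^'m"
  shows "f differentiable (at p) \<Longrightarrow> partial i (\<lambda>q. f q $ k) p = partial i f p $ k"
  by (rule partial_bounded_linear[OF bounded_linear_vec_nth])

lemma partial_add:
  assumes "f differentiable (at p)" "g differentiable (at p)"
  shows "partial i (\<lambda>q. f q + g q) p = partial i f p + partial i g p"
  using partial_eqI[OF has_derivative_add[OF assms[THEN has_derivative_partial]]] by (simp add: partial_def)

lemma partial_diff:
  assumes "f differentiable (at p)" "g differentiable (at p)"
  shows "partial i (\<lambda>q. f q - g q) p = partial i f p - partial i g p"
  using partial_eqI[OF has_derivative_diff[OF assms[THEN has_derivative_partial]]] by (simp add: partial_def)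

lemma partial_scaleR:
  assumes "f differentiable (at p)" "g differentiable (at p)"
  shows "partial i (\<lambda>q. f q *\<^sub>R g q) p = f p *\<^sub>R partial i g p + partial i f p *\<^sub>R g p"
  using partial_eqI[OF has_derivative_scaleR[OF assms[THEN has_derivative_partial]]] by (simp add: partial_def)

lemma partial_mult:
  fixes f g :: "real^'n \<Rightarrow> real"
  assumes "f differentiable (at p)" "g differentiable (at p)"
  shows "partial i (\<lambda>q. f q * g q) p = f p * partial i g p + partial i f p * g p"
  using partial_scaleR[OF assms] by simp

lemma partial_divide:
  fixes f g :: "real^'n \<Rightarrow> real"
  assumes "f differentiable (at p)" "g differentiable (at p)" "g p \<noteq> 0"
  shows "partial i (\<lambda>q. f q / g q) p = (partial i f p * g p - f p * partial i g p) / (g p)\<^sup>2"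
  using partial_eqI[OF has_derivative_divide'[OF assms(1,2)[THEN has_derivative_partial] assms(3)]]
  by (simp add: partial_def power2_eq_square)

lemma partial_cong:
  assumes "f differentiable (at p)" "open S" "p \<in> S" "\<And>q. q \<in> S \<Longrightarrow> f q = g q"
  shows "partial i f p = partial i g p"
  using frechet_derivative_transform_within_open[OF assms] by (simp add: partial_def)

section \<open>Symmetry of second derivatives\<close>

lemma has_real_derivative_along_line:
  fixes f :: "'a::real_normed_vector \<Rightarrow> real"
  assumes "(f has_derivative f') (at (p + s *\<^sub>R v))"
  shows "((\<lambda>s. f (p + s *\<^sub>R v)) has_real_derivative f' v) (at s)"
proof -
  have "((\<lambda>s. p + s *\<^sub>R v) has_derivative (\<lambda>k. k *\<^sub>R v)) (at s)"
    by (auto intro!: derivative_eq_intros)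
  from has_derivative_compose[OF this assms]
  have "((\<lambda>s. f (p + s *\<^sub>R v)) has_derivative (\<lambda>k. f' (k *\<^sub>R v))) (at s)" .
  moreover have "f' (k *\<^sub>R v) = f' v * k" for k
    using has_derivative_linear[OF assms] by (simp add: linear_cmul)
  ultimately show ?thesis
    by (simp add: has_field_derivative_def)
qed

lemma second_difference_quotient:
  fixes f :: "real^'n \<Rightarrow> real"
  assumes f: "smooth_on S f" and S: "open S" "p \<in> S" and "e > 0"
  obtains d where "d > 0"
    "\<And>h. 0 < h \<Longrightarrow> h < d \<Longrightarrow>
       \<bar>(f (p + h *\<^sub>R v + h *\<^sub>R w) - f (p + h *\<^sub>R v) - f (p + h *\<^sub>R w) + f p) / h\<^sup>2
         - frechet_derivative (\<lambda>q. frechet_derivative f (at q) v) (at p) w\<bar> < e"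
proof -
  let ?f1 = "\<lambda>q. frechet_derivative f (at q) v"
  let ?f2 = "\<lambda>q. frechet_derivative ?f1 (at q) w"
  have f1: "smooth_on S ?f1" and f2: "smooth_on S ?f2"
    using f by (simp_all add: smooth_on_frechet_derivative)
  have "continuous (at p) ?f2"
    using f2 S differentiable_imp_continuous_within smooth_on_differentiable by blast
  then obtain d0 where d0: "d0 > 0" "\<And>q. dist q p < d0 \<Longrightarrow> \<bar>?f2 q - ?f2 p\<bar> < e"
    using \<open>e > 0\<close> unfolding continuous_at_eps_delta by (auto simp: dist_real_def)
  obtain d1 where d1: "d1 > 0" "ball p d1 \<subseteq> S"
    using S open_contains_ball by blast
  define d2 where "d2 = min d0 d1"
  define d where "d = d2 / (norm v + norm w + 1)"
  have pos: "norm v + norm w + 1 > 0"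
    using norm_ge_zero[of v] norm_ge_zero[of w] by linarith
  have "d2 > 0"
    using d0 d1 by (simp add: d2_def)
  then have "d > 0"
    using pos by (simp add: d_def)
  moreover have "\<bar>(f (p + h *\<^sub>R v + h *\<^sub>R w) - f (p + h *\<^sub>R v) - f (p + h *\<^sub>R w) + f p) / h\<^sup>2 - ?f2 p\<bar> < e"
    if h: "0 < h" "h < d" for h
  proof -
    have near: "dist (p + s *\<^sub>R v + t *\<^sub>R w) p < d2" if "0 \<le> s" "s \<le> h" "0 \<le> t" "t \<le> h" for s t
    proof -
      have "dist (p + s *\<^sub>R v + t *\<^sub>R w) p \<le> norm (s *\<^sub>R v) + norm (t *\<^sub>R w)"
        by (metis add.assoc add_diff_cancel_left' dist_norm norm_triangle_ineq)
      also have "\<dots> \<le> h * norm v + h * norm w"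
        using that by (simp add: add_mono mult_right_mono)
      also have "\<dots> \<le> h * (norm v + norm w + 1)"
        using h by (simp add: algebra_simps)
      also have "\<dots> < d2"
        using h pos by (simp add: d_def pos_less_divide_eq)
      finally show ?thesis .
    qed
    have inS: "p + s *\<^sub>R v + t *\<^sub>R w \<in> S" if "0 \<le> s" "s \<le> h" "0 \<le> t" "t \<le> h" for s t
      using near[OF that] d1 by (auto simp: d2_def dist_commute)
    have der1: "((\<lambda>s. f (p + t *\<^sub>R w + s *\<^sub>R v)) has_real_derivative ?f1 (p + s *\<^sub>R v + t *\<^sub>R w)) (at s)"
      if "0 \<le> s" "s \<le> h" "0 \<le> t" "t \<le> h" for s t
      using has_real_derivative_along_line[OF smooth_on_has_derivative[OF f S(1)], of "p + t *\<^sub>R w" s v]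
        inS[OF that] by (simp add: algebra_simps)
    have "\<exists>s>0. s < h \<and>
        (f (p + h *\<^sub>R w + h *\<^sub>R v) - f (p + 0 *\<^sub>R w + h *\<^sub>R v)) - (f (p + h *\<^sub>R w + 0 *\<^sub>R v) - f (p + 0 *\<^sub>R w + 0 *\<^sub>R v))
         = (h - 0) * (?f1 (p + s *\<^sub>R v + h *\<^sub>R w) - ?f1 (p + s *\<^sub>R v + 0 *\<^sub>R w))"
      by (rule MVT2[OF h(1)]) (intro DERIV_diff der1; use h in simp)
    then obtain s where s: "0 < s" "s < h"
      "f (p + h *\<^sub>R v + h *\<^sub>R w) - f (p + h *\<^sub>R v) - f (p + h *\<^sub>R w) + f p
         = h * (?f1 (p + s *\<^sub>R v + h *\<^sub>R w) - ?f1 (p + s *\<^sub>R v))"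
      by (auto simp: algebra_simps)
    have "\<exists>t>0. t < h \<and> ?f1 (p + s *\<^sub>R v + h *\<^sub>R w) - ?f1 (p + s *\<^sub>R v + 0 *\<^sub>R w)
        = (h - 0) * ?f2 (p + s *\<^sub>R v + t *\<^sub>R w)"
      by (rule MVT2[OF h(1)])
        (use s in \<open>intro has_real_derivative_along_line smooth_on_has_derivative[OF f1 S(1)] inS; simp\<close>)
    then obtain t where t: "0 < t" "t < h" "?f1 (p + s *\<^sub>R v + h *\<^sub>R w) - ?f1 (p + s *\<^sub>R v)
        = h * ?f2 (p + s *\<^sub>R v + t *\<^sub>R w)"
      by auto
    have "(f (p + h *\<^sub>R v + h *\<^sub>R w) - f (p + h *\<^sub>R v) - f (p + h *\<^sub>R w) + f p) / h\<^sup>2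
        = ?f2 (p + s *\<^sub>R v + t *\<^sub>R w)"
      using h by (simp add: s(3) t(3) power2_eq_square)
    moreover have "dist (p + s *\<^sub>R v + t *\<^sub>R w) p < d0"
      using near[of s t] s t by (simp add: d2_def)
    ultimately show ?thesis
      using d0(2) by metis
  qed
  ultimately show thesis by (rule that)
qed

lemma frechet_derivative_commute_real:
  fixes f :: "real^'n \<Rightarrow> real"
  assumes "smooth_on S f" "open S" "p \<in> S"
  shows "frechet_derivative (\<lambda>q. frechet_derivative f (at q) v) (at p) w
       = frechet_derivative (\<lambda>q. frechet_derivative f (at q) w) (at p) v" (is "?a = ?b")
proof (rule ccontr)
  assume "?a \<noteq> ?b"
  then have e: "\<bar>?a - ?b\<bar> / 2 > 0" by simp
  from second_difference_quotient[OF assms e, of v w] second_difference_quotient[OF assms e, of w v]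
  obtain d1 d2 where d: "d1 > 0" "d2 > 0" and
    1: "\<And>h. 0 < h \<Longrightarrow> h < d1 \<Longrightarrow>
     \<bar>(f (p + h *\<^sub>R v + h *\<^sub>R w) - f (p + h *\<^sub>R v) - f (p + h *\<^sub>R w) + f p) / h\<^sup>2 - ?a\<bar> < \<bar>?a - ?b\<bar> / 2" and
    2: "\<And>h. 0 < h \<Longrightarrow> h < d2 \<Longrightarrow>
     \<bar>(f (p + h *\<^sub>R w + h *\<^sub>R v) - f (p + h *\<^sub>R w) - f (p + h *\<^sub>R v) + f p) / h\<^sup>2 - ?b\<bar> < \<bar>?a - ?b\<bar> / 2"
    by metis
  define h where "h = min d1 d2 / 2"
  have h: "0 < h" "h < d1" "h < d2"
    using d by (auto simp: h_def)
  have eq: "f (p + h *\<^sub>R w + h *\<^sub>R v) - f (p + h *\<^sub>R w) - f (p + h *\<^sub>R v) + f p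
      = f (p + h *\<^sub>R v + h *\<^sub>R w) - f (p + h *\<^sub>R v) - f (p + h *\<^sub>R w) + f p"
    by (simp add: algebra_simps)
  from 1[OF h(1,2)] 2[OF h(1,3), unfolded eq] show False by argo
qed

lemma partial_commute:
  fixes f :: "real^'n \<Rightarrow> real^'m"
  assumes f: "smooth_on S f" and S: "open S" "p \<in> S"
  shows "partial i (partial j f) p = partial j (partial i f) p"
proof -
  have comp: "partial i (partial j f) p $ k
      = frechet_derivative (\<lambda>q. frechet_derivative (\<lambda>q. f q $ k) (at q) (axis j 1)) (at p) (axis i 1)" for i j k
  proof -
    have "partial i (partial j f) p $ k = partial i (\<lambda>q. partial j f q $ k) p"
      using smooth_on_differentiable[OF smooth_on_partial[OF f] S] by (simp add: partial_component)
    also have "\<dots> = partial i (\<lambda>q. partial j (\<lambda>q. f q $ k) q) p"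
      using f S by (intro partial_cong[where S = S] smooth_on_differentiable[where S = S]
          smooth_on_component smooth_on_partial)
        (auto simp: partial_component smooth_on_differentiable)
    finally show ?thesis by (simp add: partial_def)
  qed
  show ?thesis
    by (simp add: vec_eq_iff comp)
      (simp add: frechet_derivative_commute_real[OF smooth_on_component[OF f S(1)] S])
qed

section \<open>Half-space metrics\<close>

definition diag_form :: "real \<Rightarrow> real^3^3" where
  "diag_form e = (\<chi> i j. if i \<noteq> j then 0 else if i = 3 then e else 1)"

lemma euclidean_form_eq_diag_form: "euclidean_form = diag_form 1"
  by (simp add: diag_form_def mat_def vec_eq_iff)

lemma minkowski_form_eq_diag_form: "minkowski_form = diag_form (- 1)"
  by (simp add: diag_form_def minkowski_form_def)

lemma pairing_diag_form: "pairing (diag_form e) v w = v $ 1 * w $ 1 + v $ 2 * w $ 2 + e * (v $ 3 * w $ 3)"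
  by (simp add: pairing_def diag_form_def matrix_vector_mult_def inner_vec_def sum_3)

lemma pairing_scaleR_form: "pairing (a *\<^sub>R G) v w = a * pairing G v w"
  by (simp add: pairing_def scaleR_matrix_vector_assoc[symmetric])

lemma bounded_bilinear_pairing: "bounded_bilinear (pairing G)"
proof -
  have "bounded_bilinear (\<lambda>v w. v \<bullet> (G *v w))"
    by (intro bounded_bilinear.comp[OF bounded_bilinear_inner, where f = "\<lambda>v. v", simplified]
        bounded_linear_ident matrix_vector_mul_bounded_linear)
  then show ?thesis by (simp add: pairing_def[abs_def])
qed

lemma pairing_diag_form_commute: "pairing (diag_form e) v w = pairing (diag_form e) w v"
  by (simp add: pairing_diag_form mult.commute)

lemma matrix_inv_eqI:
  fixes A B :: "'a::field^'n^'n"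
  assumes "A ** B = mat 1" "B ** A = mat 1"
  shows "matrix_inv A = B"
  unfolding matrix_inv_def
proof (rule some_equality)
  fix C assume "A ** C = mat 1 \<and> C ** A = mat 1"
  then have "C ** (A ** B) = B"
    by (simp add: matrix_mul_assoc)
  then show "C = B"
    using assms by simp
qed (use assms in simp)

lemma matrix_inv_half_space_metric:
  assumes "e * e = 1" "y $ 3 \<noteq> 0"
  shows "matrix_inv (half_space_metric (diag_form e) y) = (y $ 3)\<^sup>2 *\<^sub>R diag_form e"
proof (rule matrix_inv_eqI)
  have "diag_form e ** diag_form e = mat 1"
    using assms(1) by (simp add: diag_form_def matrix_matrix_mult_def mat_def vec_eq_iff sum_3 forall_3)
  then show "half_space_metric (diag_form e) y ** ((y $ 3)\<^sup>2 *\<^sub>R diag_form e) = mat 1"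
    and "((y $ 3)\<^sup>2 *\<^sub>R diag_form e) ** half_space_metric (diag_form e) y = mat 1"
    using assms(2) by (simp_all add: half_space_metric_def scalar_matrix_assoc[symmetric] matrix_scalar_ac)
qed

lemma partial_half_space_metric:
  assumes "y $ 3 \<noteq> 0"
  shows "partial i (\<lambda>q. half_space_metric J q $ l $ j) y = - 2 / (y $ 3)^3 * (if i = 3 then 1 else 0) * J $ l $ j"
proof -
  have "((\<lambda>q. half_space_metric J q $ l $ j) has_derivative
      (\<lambda>v. - 2 / (y $ 3)^3 * v $ 3 * J $ l $ j)) (at y)"
    unfolding half_space_metric_def using assms
    by (auto intro!: derivative_eq_intros bounded_linear_imp_has_derivative bounded_linear_vec_nth simp: field_simps eval_nat_numeral)
  from partial_eqI[OF this] show ?thesis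
    by (simp add: axis_def)
qed

lemma christoffel_half_space_metric:
  assumes "e * e = 1" "y $ 3 \<noteq> 0"
  shows "christoffel (half_space_metric (diag_form e)) y k l m =
    ((if k = 3 then e * diag_form e $ l $ m else 0)
      - (if k = l \<and> m = 3 then 1 else 0) - (if k = m \<and> l = 3 then 1 else 0)) / y $ 3"
proof -
  have "\<forall>k l m. christoffel (half_space_metric (diag_form e)) y k l m =
    ((if k = 3 then e * diag_form e $ l $ m else 0)
      - (if k = l \<and> m = 3 then 1 else 0) - (if k = m \<and> l = 3 then 1 else 0)) / y $ 3"
    using assms
    unfolding christoffel_def matrix_inv_half_space_metric[OF assms] partial_half_space_metric[OF assms(2)]
    by (auto simp: forall_3 sum_3 diag_form_def field_simps eval_nat_numeral)
  then show ?thesis by blast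
qed

lemma Gram_pairing_diag_form:
  fixes a b n :: "real^3" and e :: real
  defines "B \<equiv> pairing (diag_form e)"
  assumes "B n a = 0" "B n b = 0"
  shows "(B a a * B b b - (B a b)\<^sup>2) * B n n =
    e * (a$1 * (b$2 * n$3 - b$3 * n$2) - a$2 * (b$1 * n$3 - b$3 * n$1) + a$3 * (b$1 * n$2 - b$2 * n$1))\<^sup>2"
proof -
  have "B a a * (B b b * B n n - B n b * B n b) - B a b * (B a b * B n n - B n b * B n a)
      + B n a * (B a b * B n b - B b b * B n a) =
    e * (a$1 * (b$2 * n$3 - b$3 * n$2) - a$2 * (b$1 * n$3 - b$3 * n$1) + a$3 * (b$1 * n$2 - b$2 * n$1))\<^sup>2"
    unfolding B_def pairing_diag_form by algebra
  then show ?thesis using assms(2,3) by (simp add: algebra_simps power2_eq_square)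
qed

lemma pairing_diag_form_nondegenerate:
  fixes a b n V :: "real^3" and e :: real
  defines "B \<equiv> pairing (diag_form e)"
  assumes "B n a = 0" "B n b = 0" "B n n \<noteq> 0" "B a a * B b b - (B a b)\<^sup>2 \<noteq> 0" "e \<noteq> 0"
    and V: "B V a = 0" "B V b = 0" "B V n = 0"
  shows "V = 0"
proof -
  define D where "D = a$1 * (b$2 * n$3 - b$3 * n$2) - a$2 * (b$1 * n$3 - b$3 * n$1) + a$3 * (b$1 * n$2 - b$2 * n$1)"
  have "D \<noteq> 0"
    using Gram_pairing_diag_form[of e n a b] assms(2-5) by (auto simp: B_def D_def)
  have "D * V$1 = 0" "D * V$2 = 0" "D * (e * V$3) = 0"
    using V unfolding B_def pairing_diag_form D_def by algebra+
  then show ?thesis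
    using \<open>D \<noteq> 0\<close> \<open>e \<noteq> 0\<close> by (simp add: vec_eq_iff forall_3)
qed

lemma matrix_inv_2:
  fixes A :: "real^2^2"
  assumes "det A \<noteq> 0"
  shows "matrix_inv A $ 1 $ 1 = A $ 2 $ 2 / det A" "matrix_inv A $ 1 $ 2 = - A $ 1 $ 2 / det A"
    "matrix_inv A $ 2 $ 1 = - A $ 2 $ 1 / det A" "matrix_inv A $ 2 $ 2 = A $ 1 $ 1 / det A"
proof -
  define M :: "real^2^2" where "M = (\<chi> i j. if i = j then A $ (if i = 1 then 2 else 1) $ (if i = 1 then 2 else 1)
    else - A $ i $ j)"
  have "A ** M = det A *\<^sub>R mat 1" "M ** A = det A *\<^sub>R mat 1"
    by (simp_all add: M_def matrix_matrix_mult_def mat_def vec_eq_iff sum_2 forall_2 det_2)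
  then have "matrix_inv A = (1 / det A) *\<^sub>R M"
    using assms by (intro matrix_inv_eqI) (simp_all add: matrix_scalar_ac scalar_matrix_assoc[symmetric])
  then show "matrix_inv A $ 1 $ 1 = A $ 2 $ 2 / det A" "matrix_inv A $ 1 $ 2 = - A $ 1 $ 2 / det A"
    "matrix_inv A $ 2 $ 1 = - A $ 2 $ 1 / det A" "matrix_inv A $ 2 $ 2 = A $ 1 $ 1 / det A"
    by (simp_all add: M_def)
qed

section \<open>The Gauss equation\<close>

lemma partial_pairing:
  assumes "f differentiable (at p)" "g differentiable (at p)"
  shows "partial i (\<lambda>q. pairing G (f q) (g q)) p = pairing G (f p) (partial i g p) + pairing G (partial i f p) (g p)"
  using partial_eqI[OF bounded_bilinear.FDERIV[OF bounded_bilinear_pairing assms[THEN has_derivative_partial]]]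
  by (simp add: partial_def)

lemma smooth_on_pairing:
  "smooth_on S f \<Longrightarrow> smooth_on S g \<Longrightarrow> open S \<Longrightarrow> smooth_on S (\<lambda>p. pairing G (f p) (g p))"
  by (simp add: smooth_on_def Ck_on_bilinear[OF _ bounded_bilinear_pairing])

lemmas smooth_on_intros = smooth_on_const smooth_on_add smooth_on_diff smooth_on_minus smooth_on_mult
  smooth_on_scaleR smooth_on_divide smooth_on_power smooth_on_component smooth_on_partial smooth_on_pairing

definition conformal_factor :: "real \<Rightarrow> ('a \<Rightarrow> real^3) \<Rightarrow> ('a \<Rightarrow> real^3) \<Rightarrow> 'a chart \<Rightarrow> real^2 \<Rightarrow> real" where
  "conformal_factor e x N c u =
    (let I = first_form (diag_form e) x c u; II = second_form (diag_form e) x N c u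
     in (I $ 2 $ 2 * II $ 1 $ 1 - 2 * I $ 1 $ 2 * II $ 1 $ 2 + I $ 1 $ 1 * II $ 2 $ 2) / det I
        - 2 * e * local_rep c (normal_gauss_map x N) u $ 3)"

locale half_space_patch =
  fixes c :: "'a chart" and x N :: "'a \<Rightarrow> real^3" and e :: real
  assumes e_cases: "e = 1 \<or> e = - 1"
    and open_U: "open (chart_image c)"
    and smooth_X: "smooth_on (chart_image c) (local_rep c x)"
    and smooth_n: "smooth_on (chart_image c) (local_rep c N)"
    and X3_pos: "u \<in> chart_image c \<Longrightarrow> local_rep c x u $ 3 > 0"
    and normal_normal: "u \<in> chart_image c \<Longrightarrow>
      pairing (half_space_metric (diag_form e) (local_rep c x u)) (local_rep c N u) (local_rep c N u) = e"
    and normal_tangent: "u \<in> chart_image c \<Longrightarrow>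
      pairing (half_space_metric (diag_form e) (local_rep c x u)) (local_rep c N u) (partial i (local_rep c x) u) = 0"
    and det_first_form: "u \<in> chart_image c \<Longrightarrow> det (first_form (diag_form e) x c u) \<noteq> 0"
begin

abbreviation "U \<equiv> chart_image c"
abbreviation "X \<equiv> local_rep c x"
abbreviation "n \<equiv> local_rep c N"
abbreviation "J \<equiv> diag_form e"
abbreviation "B \<equiv> pairing J"
abbreviation "I \<equiv> first_form J x c"
abbreviation "II \<equiv> second_form J x N c"
abbreviation "\<Gamma> \<equiv> christoffel I"

definition z :: "real^2 \<Rightarrow> real" where "z u = 1 / X u $ 3"

definition g :: "real^2 \<Rightarrow> real^3 \<Rightarrow> real^3 \<Rightarrow> real" where "g u v w = (z u)\<^sup>2 * B v w"

text \<open>The ambient covariant derivative along the \<open>i\<close>-th coordinate field of the surface, with the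
  Christoffel symbols of \<open>J / x\<^sub>3\<^sup>2\<close> written out.\<close>

definition cov :: "2 \<Rightarrow> (real^2 \<Rightarrow> real^3) \<Rightarrow> real^2 \<Rightarrow> real^3" where
  "cov i V u = partial i V u - z u *\<^sub>R (partial i X u $ 3 *\<^sub>R V u + V u $ 3 *\<^sub>R partial i X u
      - (e * B (partial i X u) (V u)) *\<^sub>R axis 3 1)"

lemma e_square: "e * e = 1"
  using e_cases by auto

lemma pairing_half_space_metric: "pairing (half_space_metric J (X u)) v w = g u v w"
  by (simp add: half_space_metric_def pairing_scaleR_form g_def z_def power_one_over)

lemma g_add [simp]: "g u (v + v') w = g u v w + g u v' w" "g u w (v + v') = g u w v + g u w v'"
  and g_diff [simp]: "g u (v - v') w = g u v w - g u v' w" "g u w (v - v') = g u w v - g u w v'"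
  and g_scaleR [simp]: "g u (a *\<^sub>R v) w = a * g u v w" "g u w (a *\<^sub>R v) = a * g u w v"
  by (simp_all add: g_def pairing_diag_form algebra_simps)

lemma g_commute: "g u v w = g u w v"
  by (simp add: g_def pairing_diag_form_commute)

lemma first_form_eq: "I u $ i $ j = g u (partial i X u) (partial j X u)"
  by (simp add: first_form_def pairing_half_space_metric)

lemma z_pos: "u \<in> U \<Longrightarrow> z u > 0"
  using X3_pos by (simp add: z_def)

lemma g_n_n: "u \<in> U \<Longrightarrow> g u (n u) (n u) = e"
  using normal_normal by (simp add: pairing_half_space_metric)

lemma g_n_X: "u \<in> U \<Longrightarrow> g u (n u) (partial i X u) = 0"
  using normal_tangent by (simp add: pairing_half_space_metric)

lemma differentiable: "smooth_on U f \<Longrightarrow> u \<in> U \<Longrightarrow> f differentiable (at u)"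
  by (rule smooth_on_differentiable[OF _ open_U])

lemma smooth_z: "smooth_on U z"
  unfolding z_def using X3_pos
  by (intro smooth_on_intros smooth_X open_U) force

lemma partial_z: "u \<in> U \<Longrightarrow> partial i z u = - (z u)\<^sup>2 * partial i X u $ 3"
  unfolding z_def using X3_pos[of u] smooth_X
  by (simp add: partial_divide partial_component partial_const differentiable smooth_on_component open_U
      smooth_on_const power_one_over)

lemma smooth_g: "smooth_on U V \<Longrightarrow> smooth_on U W \<Longrightarrow> smooth_on U (\<lambda>u. g u (V u) (W u))"
  unfolding g_def by (intro smooth_on_intros smooth_z open_U)

lemma smooth_first_form: "smooth_on U (\<lambda>u. I u $ i $ j)"
  unfolding first_form_eq by (intro smooth_g smooth_on_partial smooth_X)

lemma smooth_cov: "smooth_on U V \<Longrightarrow> smooth_on U (cov i V)"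
  unfolding cov_def[abs_def] by (intro smooth_on_intros smooth_z smooth_X open_U)

lemma ambient_deriv_eq:
  assumes "u \<in> U"
  shows "ambient_deriv J x c u i j = cov i (partial j X) u"
proof -
  have X3: "X u $ 3 \<noteq> 0"
    using X3_pos[OF assms] by simp
  show ?thesis
    unfolding ambient_deriv_def cov_def christoffel_half_space_metric[OF e_square X3] pairing_diag_form
    by (simp add: vec_eq_iff forall_3 sum_3 z_def axis_def
        diag_form_def divide_simps X3) (simp add: algebra_simps)
qed

lemma partial_g:
  assumes "smooth_on U V" "smooth_on U W" "u \<in> U"
  shows "partial k (\<lambda>u. g u (V u) (W u)) u = g u (cov k V u) (W u) + g u (V u) (cov k W u)"
proof -
  have eq: "partial k (\<lambda>u. (z u)\<^sup>2 * B (V u) (W u)) u =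
     (z u)\<^sup>2 * (B (V u) (partial k W u) + B (partial k V u) (W u))
     - 2 * (z u)^3 * partial k X u $ 3 * B (V u) (W u)"
    unfolding power2_eq_square
    using assms smooth_z open_U
    by (simp add: partial_mult partial_pairing differentiable smooth_on_mult smooth_on_pairing partial_z
        power2_eq_square power3_eq_cube algebra_simps)
  show ?thesis
    using e_cases unfolding g_def eq unfolding cov_def
    by (elim disjE; simp add: pairing_diag_form axis_def power2_eq_square power3_eq_cube algebra_simps)
qed

lemma cov_commute: "u \<in> U \<Longrightarrow> cov i (partial j X) u = cov j (partial i X) u"
  using partial_commute[OF smooth_X open_U, of u i j]
  by (simp add: cov_def pairing_diag_form_commute[of e "partial i X u"] algebra_simps)

lemma cov_cov:
  assumes V: "smooth_on U V" and "u \<in> U"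
  shows "cov k (cov i V) u - cov i (cov k V) u =
    (- e) *\<^sub>R (g u (partial i X u) (V u) *\<^sub>R partial k X u - g u (partial k X u) (V u) *\<^sub>R partial i X u)"
proof -
  have partial_cov: "partial k (cov i V) u = partial k (partial i V) u
      - (partial k z u *\<^sub>R (partial i X u $ 3 *\<^sub>R V u + V u $ 3 *\<^sub>R partial i X u
            - (e * B (partial i X u) (V u)) *\<^sub>R axis 3 1)
      + z u *\<^sub>R (partial k (partial i X) u $ 3 *\<^sub>R V u + partial i X u $ 3 *\<^sub>R partial k V u
          + partial k V u $ 3 *\<^sub>R partial i X u + V u $ 3 *\<^sub>R partial k (partial i X) u
          - (e * (B (partial k (partial i X) u) (V u) + B (partial i X u) (partial k V u))) *\<^sub>R axis 3 1))" for i k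
    unfolding cov_def[abs_def]
    using V \<open>u \<in> U\<close> smooth_z open_U smooth_X
    by (simp add: partial_diff partial_add partial_scaleR partial_mult partial_component partial_pairing
        partial_const differentiable smooth_on_intros algebra_simps)
  show ?thesis
    unfolding cov_def[of k "cov i V"] cov_def[of i "cov k V"] partial_cov
    unfolding cov_def partial_z[OF \<open>u \<in> U\<close>] partial_commute[OF V open_U \<open>u \<in> U\<close>, of i k]
      partial_commute[OF smooth_X open_U \<open>u \<in> U\<close>, of i k] g_def
    using e_cases
    by (elim disjE; simp add: vec_eq_iff forall_3 pairing_diag_form axis_def power2_eq_square algebra_simps)
qed

lemma first_form_commute: "I u $ i $ j = I u $ j $ i"
  by (simp add: first_form_eq g_commute)

lemma orthogonal_imp_0:
  assumes "u \<in> U" "g u V (partial 1 X u) = 0" "g u V (partial 2 X u) = 0" "g u V (n u) = 0"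
  shows "V = 0"
proof (rule pairing_diag_form_nondegenerate)
  have z: "z u \<noteq> 0"
    using z_pos[OF assms(1)] by simp
  show "B V (partial 1 X u) = 0" "B V (partial 2 X u) = 0" "B V (n u) = 0"
    using assms(2-4) z by (simp_all add: g_def)
  show "B (n u) (partial 1 X u) = 0" "B (n u) (partial 2 X u) = 0"
    using g_n_X[OF assms(1)] z by (simp_all add: g_def)
  show "B (n u) (n u) \<noteq> 0" "e \<noteq> 0"
    using g_n_n[OF assms(1)] e_cases by (auto simp: g_def)
  show "B (partial 1 X u) (partial 1 X u) * B (partial 2 X u) (partial 2 X u) - (B (partial 1 X u) (partial 2 X u))\<^sup>2 \<noteq> 0"
    using det_first_form[OF assms(1)]
    by (auto simp: det_2 first_form_eq g_def power2_eq_square algebra_simps pairing_diag_form_commute[of e "partial 2 X u" "partial 1 X u"])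
qed

lemma smooth_christoffel: "smooth_on U (\<lambda>u. \<Gamma> u k i j)"
proof -
  have "smooth_on U (\<lambda>u. matrix_inv (I u) $ k $ l)" for k l
  proof (rule smooth_on_cong[OF _ open_U])
    show "smooth_on U (\<lambda>u. (if k = l then I u $ (if k = 1 then 2 else 1) $ (if k = 1 then 2 else 1)
       else - I u $ k $ l) / (I u $ 1 $ 1 * I u $ 2 $ 2 - I u $ 1 $ 2 * I u $ 2 $ 1))"
    proof (intro smooth_on_divide smooth_on_diff smooth_on_mult smooth_first_form open_U)
      show "smooth_on U (\<lambda>u. if k = l then I u $ (if k = 1 then 2 else 1) $ (if k = 1 then 2 else 1) else - I u $ k $ l)"
        by (cases "k = l") (simp_all add: smooth_on_minus smooth_first_form open_U)
    qed (use det_first_form in \<open>auto simp: det_2\<close>)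
  next
    fix u assume "u \<in> U"
    then show "(if k = l then I u $ (if k = 1 then 2 else 1) $ (if k = 1 then 2 else 1)
       else - I u $ k $ l) / (I u $ 1 $ 1 * I u $ 2 $ 2 - I u $ 1 $ 2 * I u $ 2 $ 1) = matrix_inv (I u) $ k $ l"
      using exhaust_2[of k] exhaust_2[of l] matrix_inv_2[OF det_first_form] by (auto simp: det_2)
  qed
  then show ?thesis
    unfolding christoffel_def
    by (intro smooth_on_divide smooth_on_sum smooth_on_mult smooth_on_add smooth_on_diff
        smooth_on_partial[of _ "\<lambda>u. first_form _ _ _ u $ _ $ _"] smooth_first_form smooth_on_const open_U) auto
qed

lemma first_form_christoffel:
  assumes "u \<in> U"
  shows "(\<Sum>m\<in>UNIV. I u $ l $ m * \<Gamma> u m i j) =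
    (partial i (\<lambda>u. I u $ l $ j) u + partial j (\<lambda>u. I u $ l $ i) u - partial l (\<lambda>u. I u $ i $ j) u) / 2"
proof -
  define a where "a l = partial i (\<lambda>u. I u $ l $ j) u + partial j (\<lambda>u. I u $ l $ i) u - partial l (\<lambda>u. I u $ i $ j) u" for l
  have d: "det (I u) \<noteq> 0" "I u $ 1 $ 1 * I u $ 2 $ 2 = det (I u) + I u $ 1 $ 2 * I u $ 2 $ 1"
    using det_first_form[OF assms] by (auto simp: det_2)
  have \<Gamma>: "\<Gamma> u m i j = (\<Sum>l\<in>UNIV. matrix_inv (I u) $ m $ l * a l) / 2" for m
    by (simp add: christoffel_def a_def)
  have "(\<Sum>m\<in>UNIV. I u $ l $ m * \<Gamma> u m i j) = a l / 2"
    using exhaust_2[of l] d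
    by (auto simp: \<Gamma> sum_2 matrix_inv_2[OF d(1)] field_simps)
  then show ?thesis by (simp add: a_def)
qed

lemma g_cov_X:
  assumes "u \<in> U"
  shows "g u (cov i (partial j X) u) (partial l X u) = (\<Sum>m\<in>UNIV. I u $ l $ m * \<Gamma> u m i j)"
  unfolding first_form_christoffel[OF assms]
  unfolding first_form_eq
  using cov_commute[OF assms, of i j] cov_commute[OF assms, of i l] cov_commute[OF assms, of j l]
  by (simp add: partial_g smooth_on_partial smooth_X assms g_commute[of u "partial _ X u"])

definition h :: "2 \<Rightarrow> 2 \<Rightarrow> real^2 \<Rightarrow> real" where
  "h i j u = e * g u (cov i (partial j X) u) (n u)"

lemma h_commute: "u \<in> U \<Longrightarrow> h i j u = h j i u"
  by (simp add: h_def cov_commute[of u i j])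

definition normal_part :: "2 \<Rightarrow> 2 \<Rightarrow> real^2 \<Rightarrow> real^3" where
  "normal_part i j u = cov i (partial j X) u - (\<Gamma> u 1 i j *\<^sub>R partial 1 X u + \<Gamma> u 2 i j *\<^sub>R partial 2 X u)"

lemma g_normal_part_X: "u \<in> U \<Longrightarrow> g u (normal_part i j u) (partial l X u) = 0"
  by (simp add: normal_part_def g_cov_X sum_2 first_form_eq g_commute[of u "partial _ X u" "partial l X u"] algebra_simps)

lemma normal_part_eq:
  assumes "u \<in> U"
  shows "normal_part i j u = h i j u *\<^sub>R n u"
proof -
  have "normal_part i j u - h i j u *\<^sub>R n u = 0"
  proof (rule orthogonal_imp_0[OF assms])
    show "g u (normal_part i j u - h i j u *\<^sub>R n u) (n u) = 0"
      using e_square by (simp add: normal_part_def h_def g_n_n g_n_X g_commute[of u "partial _ X u"] assms)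
  qed (simp_all add: g_normal_part_X g_n_X assms)
  then show ?thesis by simp
qed

lemma second_form_eq:
  assumes "u \<in> U"
  shows "II u $ i $ j = h i j u"
proof -
  have "n u \<noteq> 0"
    using g_n_n[OF assms] e_cases by (auto simp: g_def pairing_diag_form)
  moreover have "ambient_deriv J x c u i j = induced_deriv J x c u i j + h i j u *\<^sub>R n u"
    using normal_part_eq[OF assms, of i j] by (simp add: normal_part_def ambient_deriv_eq assms induced_deriv_def sum_2 diff_eq_eq add_ac)
  ultimately show ?thesis
    by (simp add: second_form_def)
qed

lemma cov_diff: "smooth_on U V \<Longrightarrow> smooth_on U V' \<Longrightarrow> u \<in> U \<Longrightarrow>
    cov k (\<lambda>u. V u - V' u) u = cov k V u - cov k V' u"
  by (simp add: cov_def partial_diff differentiable pairing_diag_form algebra_simps)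

lemma cov_add: "smooth_on U V \<Longrightarrow> smooth_on U V' \<Longrightarrow> u \<in> U \<Longrightarrow>
    cov k (\<lambda>u. V u + V' u) u = cov k V u + cov k V' u"
  by (simp add: cov_def partial_add differentiable pairing_diag_form algebra_simps)

lemma cov_scaleR: "smooth_on U f \<Longrightarrow> smooth_on U V \<Longrightarrow> u \<in> U \<Longrightarrow>
    cov k (\<lambda>u. f u *\<^sub>R V u) u = partial k f u *\<^sub>R V u + f u *\<^sub>R cov k V u"
  by (simp add: cov_def partial_scaleR differentiable pairing_diag_form algebra_simps)

lemma cov_normal_part:
  assumes "u \<in> U"
  shows "cov k (normal_part i j) u = cov k (cov i (partial j X)) u
    - (partial k (\<lambda>u. \<Gamma> u 1 i j) u *\<^sub>R partial 1 X u + \<Gamma> u 1 i j *\<^sub>R cov k (partial 1 X) u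
     + partial k (\<lambda>u. \<Gamma> u 2 i j) u *\<^sub>R partial 2 X u + \<Gamma> u 2 i j *\<^sub>R cov k (partial 2 X) u)"
  unfolding normal_part_def[abs_def] using assms
  by (simp add: cov_diff cov_add cov_scaleR smooth_christoffel smooth_cov smooth_on_intros smooth_X open_U)

lemma g_cov_normal_part:
  assumes "u \<in> U"
  shows "g u (cov k (normal_part i j) u) (partial l X u) = - e * h i j u * h k l u"
proof -
  have smooth_normal_part: "smooth_on U (normal_part i j)"
    unfolding normal_part_def[abs_def]
    by (intro smooth_on_diff smooth_on_add smooth_on_scaleR smooth_christoffel smooth_cov smooth_on_partial smooth_X open_U)
  have "partial k (\<lambda>u. g u (normal_part i j u) (partial l X u)) u = partial k (\<lambda>u. 0) u"
    by (rule partial_cong[OF differentiable open_U assms])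
      (simp_all add: smooth_g smooth_normal_part smooth_on_partial smooth_X g_normal_part_X assms)
  then have "g u (cov k (normal_part i j) u) (partial l X u) + g u (normal_part i j u) (cov k (partial l X) u) = 0"
    by (simp add: partial_g smooth_normal_part smooth_on_partial smooth_X assms partial_const)
  moreover have "g u (normal_part i j u) (cov k (partial l X) u) = e * h i j u * h k l u"
    using e_cases by (auto simp: normal_part_eq assms h_def g_commute[of u "n u"])
  ultimately show ?thesis by simp
qed

lemma gauss_equation:
  assumes "u \<in> U"
  shows "curvature I u = - e + e * (det (II u) / det (I u))"
proof -
  have 1: "g u (cov k (cov i (partial j X)) u) (partial l X u) =
     - e * h i j u * h k l u
     + (partial k (\<lambda>u. \<Gamma> u 1 i j) u * I u $ l $ 1
     + \<Gamma> u 1 i j * (I u $ l $ 1 * \<Gamma> u 1 k 1 + I u $ l $ 2 * \<Gamma> u 2 k 1)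
     + partial k (\<lambda>u. \<Gamma> u 2 i j) u * I u $ l $ 2
     + \<Gamma> u 2 i j * (I u $ l $ 1 * \<Gamma> u 1 k 2 + I u $ l $ 2 * \<Gamma> u 2 k 2))" for k i j l
    using g_cov_normal_part[OF assms, of k i j l] unfolding cov_normal_part[OF assms]
    by (simp add: g_cov_X assms sum_2 first_form_eq g_commute[of u "partial l X u"])
  have "g u (cov 1 (cov 2 (partial 2 X)) u - cov 2 (cov 1 (partial 2 X)) u) (partial 1 X u)
    = - e * (I u $ 2 $ 2 * I u $ 1 $ 1 - I u $ 1 $ 2 * I u $ 2 $ 1)"
    by (subst cov_cov) (simp_all add: smooth_on_partial smooth_X assms first_form_eq algebra_simps)
  then have "(\<Sum>l\<in>UNIV. I u $ 1 $ l * riemann I u l 2 1 2) =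
    - e * (I u $ 2 $ 2 * I u $ 1 $ 1 - I u $ 1 $ 2 * I u $ 2 $ 1) + e * (h 1 1 u * h 2 2 u - h 1 2 u * h 2 1 u)"
    by (simp add: 1 riemann_def sum_2 algebra_simps)
  also have "\<dots> = - e * det (I u) + e * det (II u)"
    by (simp add: det_2 second_form_eq assms algebra_simps)
  finally show ?thesis
    using det_first_form[OF assms] by (simp add: curvature_def diff_divide_distrib add_divide_distrib)
qed

section \<open>The normal Gauss map\<close>

abbreviation "\<eta> \<equiv> local_rep c (normal_gauss_map x N)"
abbreviation "IV \<equiv> fourth_form J x N c"

lemma normal_gauss_map_eq: "\<eta> u = z u *\<^sub>R n u"
  by (simp add: local_rep_def normal_gauss_map_def z_def)

lemma smooth_normal_gauss_map: "smooth_on U \<eta>"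
  unfolding normal_gauss_map_eq[abs_def] by (intro smooth_on_scaleR smooth_z smooth_n open_U)

lemma g_n_eq: "g u v (n u) = z u * B v (\<eta> u)"
  by (simp add: g_def normal_gauss_map_eq pairing_diag_form power2_eq_square algebra_simps)

lemma pairing_gauss_X: "u \<in> U \<Longrightarrow> B (\<eta> u) (partial i X u) = 0"
  using g_n_X[of u i] z_pos[of u] by (simp add: g_commute[of u "n u"] g_n_eq pairing_diag_form_commute)

lemma pairing_gauss_gauss: "u \<in> U \<Longrightarrow> B (\<eta> u) (\<eta> u) = e"
  using g_n_n[of u] by (simp add: g_n_eq normal_gauss_map_eq pairing_diag_form algebra_simps)

lemma pairing_gauss_partial_gauss:
  assumes "u \<in> U"
  shows "B (\<eta> u) (partial i \<eta> u) = 0"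
proof -
  have "partial i (\<lambda>u. B (\<eta> u) (\<eta> u)) u = partial i (\<lambda>u. e) u"
    by (rule partial_cong[OF differentiable open_U assms])
      (simp_all add: smooth_on_pairing smooth_normal_gauss_map open_U pairing_gauss_gauss assms)
  then show ?thesis
    by (simp add: partial_pairing differentiable smooth_normal_gauss_map assms partial_const
        pairing_diag_form_commute[of e "partial i \<eta> u"])
qed

lemma pairing_gauss_partial_partial:
  assumes "u \<in> U"
  shows "B (\<eta> u) (partial i (partial j X) u) = - B (partial j X u) (partial i \<eta> u)"
proof -
  have "partial i (\<lambda>u. B (\<eta> u) (partial j X u)) u = partial i (\<lambda>u. 0) u"
    by (rule partial_cong[OF differentiable open_U assms])
      (simp_all add: smooth_on_pairing smooth_normal_gauss_map smooth_on_partial smooth_X open_U pairing_gauss_X assms)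
  then show ?thesis
    by (simp add: partial_pairing differentiable smooth_normal_gauss_map smooth_on_partial smooth_X assms partial_const
        pairing_diag_form_commute[of e "partial i \<eta> u"])
qed

lemma second_form_gauss:
  assumes "u \<in> U"
  shows "II u $ i $ j = e * (\<eta> u $ 3 * I u $ i $ j - z u * B (partial i X u) (partial j \<eta> u))"
proof -
  have "B (cov j (partial i X) u) (\<eta> u) = B (\<eta> u) (partial j (partial i X) u)
      - z u * (partial j X u $ 3 * B (\<eta> u) (partial i X u) + partial i X u $ 3 * B (\<eta> u) (partial j X u)
          - (e * e) * B (partial j X u) (partial i X u) * \<eta> u $ 3)"
    by (simp add: cov_def pairing_diag_form axis_def algebra_simps)
  then have eq: "B (cov j (partial i X) u) (\<eta> u) = z u * B (partial i X u) (partial j X u) * \<eta> u $ 3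
      - B (partial i X u) (partial j \<eta> u)"
    by (simp add: e_square pairing_gauss_X pairing_gauss_partial_partial assms pairing_diag_form_commute)
  have "II u $ i $ j = e * (z u * B (cov j (partial i X) u) (\<eta> u))"
    by (simp only: second_form_eq[OF assms] h_def g_n_eq cov_commute[OF assms, of i j])
  then show ?thesis
    unfolding first_form_eq g_def eq
    by (simp add: power2_eq_square algebra_simps)
qed

lemma det_first_form_scaleR_partial_gauss:
  assumes "u \<in> U"
  shows "det (I u) *\<^sub>R partial i \<eta> u =
     (I u $ 2 $ 2 * g u (partial 1 X u) (partial i \<eta> u) - I u $ 1 $ 2 * g u (partial 2 X u) (partial i \<eta> u)) *\<^sub>R partial 1 X u
   + (I u $ 1 $ 1 * g u (partial 2 X u) (partial i \<eta> u) - I u $ 1 $ 2 * g u (partial 1 X u) (partial i \<eta> u)) *\<^sub>R partial 2 X u"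
    (is "?l = ?r")
proof -
  have "?l - ?r = 0"
  proof (rule orthogonal_imp_0[OF assms])
    show "g u (?l - ?r) (n u) = 0"
      using pairing_gauss_X[OF assms] pairing_gauss_partial_gauss[OF assms]
      by (simp add: g_n_eq[of u "partial _ _ u"] pairing_diag_form_commute)
    show "g u (?l - ?r) (partial 1 X u) = 0" "g u (?l - ?r) (partial 2 X u) = 0"
      by (simp_all add: det_2 first_form_eq[symmetric] g_commute[of u "partial i \<eta> u"])
        (simp_all add: first_form_commute[of u 2 1] algebra_simps)
  qed
  then show ?thesis by simp
qed

lemma fourth_form_eq:
  assumes "u \<in> U"
  shows "IV u = conformal_factor e x N c u *\<^sub>R II u
     - (e * (curvature I u - (- e + e * (\<eta> u $ 3)\<^sup>2))) *\<^sub>R I u"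
proof -
  define b where "b i j = z u * B (partial i X u) (partial j \<eta> u)" for i j
  define G where "G i j = I u $ i $ j" for i j
  define d where "d = det (I u)"
  have d: "d \<noteq> 0" "d = G 1 1 * G 2 2 - G 1 2 * G 1 2" and G21: "G 2 1 = G 1 2"
    using det_first_form[OF assms] by (auto simp: d_def G_def det_2 first_form_commute[of u 2 1])
  have II: "II u $ i $ j = e * (\<eta> u $ 3 * G i j - b i j)" for i j
    by (simp add: second_form_gauss assms b_def G_def)
  have "II u $ 2 $ 1 = II u $ 1 $ 2"
    by (simp add: second_form_eq assms h_commute[OF assms, of 2 1])
  then have b21: "b 2 1 = b 1 2"
    using e_cases by (auto simp: II G21)
  have IV: "d * IV u $ i $ j = (G 2 2 * b 1 i - G 1 2 * b 2 i) * b 1 j + (G 1 1 * b 2 i - G 1 2 * b 1 i) * b 2 j" for i j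
  proof -
    have "d * IV u $ i $ j = B (d *\<^sub>R partial i \<eta> u) (partial j \<eta> u)"
      by (simp add: fourth_form_def pairing_diag_form algebra_simps)
    also have "\<dots> = (G 2 2 * b 1 i - G 1 2 * b 2 i) * b 1 j + (G 1 1 * b 2 i - G 1 2 * b 1 i) * b 2 j"
      unfolding d_def det_first_form_scaleR_partial_gauss[OF assms]
      by (simp add: bounded_bilinear.add_left[OF bounded_bilinear_pairing]
          bounded_bilinear.scaleR_left[OF bounded_bilinear_pairing])
        (simp add: G_def b_def g_def power2_eq_square algebra_simps)
    finally show ?thesis .
  qed
  define t where "t = \<eta> u $ 3"
  have rho: "d * conformal_factor e x N c u = - e * (G 2 2 * b 1 1 - 2 * G 1 2 * b 1 2 + G 1 1 * b 2 2)"
  proof -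
    have "d * (s / d - k) = s - k * d" for s k
      using d(1) by (simp add: field_simps)
    then have "d * conformal_factor e x N c u
        = G 2 2 * II u $ 1 $ 1 - 2 * G 1 2 * II u $ 1 $ 2 + G 1 1 * II u $ 2 $ 2 - 2 * e * t * d"
      unfolding conformal_factor_def Let_def d_def[symmetric] G_def[symmetric] t_def[symmetric] by blast
    then show ?thesis
      unfolding II t_def[symmetric] d(2) by (simp add: algebra_simps)
  qed
  have K: "d * (e * (curvature I u - (- e + e * (\<eta> u $ 3)\<^sup>2))) =
      (b 1 1 * b 2 2 - b 1 2 * b 1 2) - t * (G 2 2 * b 1 1 - 2 * G 1 2 * b 1 2 + G 1 1 * b 2 2)"
  proof -
    have "d * (e * (curvature I u - (- e + e * (\<eta> u $ 3)\<^sup>2))) = det (II u) - d * t\<^sup>2"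
      unfolding gauss_equation[OF assms] d_def[symmetric] t_def[symmetric]
      using d(1) e_cases by (auto simp: field_simps)
    also have "\<dots> = (b 1 1 * b 2 2 - b 1 2 * b 1 2) - t * (G 2 2 * b 1 1 - 2 * G 1 2 * b 1 2 + G 1 1 * b 2 2)"
      unfolding d(2) using e_cases
      by (auto simp: det_2 II t_def[symmetric] G21 b21 power2_eq_square algebra_simps)
    finally show ?thesis .
  qed
  have "d * IV u $ i $ j = d * (conformal_factor e x N c u * II u $ i $ j
     - (e * (curvature I u - (- e + e * (\<eta> u $ 3)\<^sup>2))) * G i j)" for i j
  proof -
    have "d * (conformal_factor e x N c u * II u $ i $ j
       - (e * (curvature I u - (- e + e * (\<eta> u $ 3)\<^sup>2))) * G i j)
      = (d * conformal_factor e x N c u) * II u $ i $ j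
       - (d * (e * (curvature I u - (- e + e * (\<eta> u $ 3)\<^sup>2)))) * G i j"
      by (simp add: algebra_simps)
    also have "\<dots> = d * IV u $ i $ j"
      unfolding rho K IV II unfolding t_def[symmetric]
      using exhaust_2[of i] exhaust_2[of j] e_cases
      by (auto simp: G21 b21 algebra_simps)
    finally show ?thesis by (rule sym)
  qed
  then show ?thesis
    using d(1) by (simp add: vec_eq_iff G_def)
qed

lemma smooth_conformal_factor: "smooth_on U (conformal_factor e x N c)"
proof -
  have II: "smooth_on U (\<lambda>u. II u $ i $ j)" for i j
  proof (rule smooth_on_cong[OF _ open_U])
    show "smooth_on U (\<lambda>u. h i j u)"
      unfolding h_def by (intro smooth_on_mult smooth_on_const smooth_g smooth_cov smooth_on_partial smooth_X smooth_n open_U)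
  qed (simp add: second_form_eq)
  show ?thesis
    unfolding conformal_factor_def[abs_def] Let_def det_2
    using det_first_form
    by (intro smooth_on_intros II smooth_first_form smooth_normal_gauss_map open_U) (simp add: det_2)
qed

end

section \<open>Change of charts\<close>

lemma chart_openin: "smooth_surface T A \<Longrightarrow> c \<in> A \<Longrightarrow> openin T (fst c)"
  and chart_image_open: "smooth_surface T A \<Longrightarrow> c \<in> A \<Longrightarrow> open (chart_image c)"
  and chart_homeomorphic_map: "smooth_surface T A \<Longrightarrow> c \<in> A \<Longrightarrow>
    homeomorphic_map (subtopology T (fst c)) (top_of_set (chart_image c)) (snd c)"
  and transition_smooth: "smooth_surface T A \<Longrightarrow> c \<in> A \<Longrightarrow> d \<in> A \<Longrightarrow>
    smooth_on (snd c ` (fst c \<inter> fst d)) (local_rep c (snd d))"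
  by (simp_all add: smooth_surface_def)

lemma chart_inj_on:
  assumes "smooth_surface T A" "c \<in> A"
  shows "inj_on (snd c) (fst c)"
  using homeomorphic_imp_injective_map[OF chart_homeomorphic_map[OF assms]] openin_subset[OF chart_openin[OF assms]]
  by (simp add: topspace_subtopology Int_absorb1)

lemma transition_domain_open:
  assumes "smooth_surface T A" "c \<in> A" "d \<in> A"
  shows "open (snd c ` (fst c \<inter> fst d))"
proof -
  have "openin (subtopology T (fst c)) (fst c \<inter> fst d)"
    using chart_openin[OF assms(1,3)] by (simp add: openin_subtopology_Int2)
  then have "openin (top_of_set (chart_image c)) (snd c ` (fst c \<inter> fst d))"
    using homeomorphic_imp_open_map[OF chart_homeomorphic_map[OF assms(1,2)]] by (simp add: open_map_def)
  then show ?thesis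
    using chart_image_open[OF assms(1,2)] by (simp add: openin_open_eq)
qed

lemma local_rep_chart: "inj_on (snd c) (fst c) \<Longrightarrow> p \<in> fst c \<Longrightarrow> local_rep c f (snd c p) = f p"
  by (simp add: local_rep_def)

lemma frechet_derivative_eq_sum_partial:
  assumes "f differentiable (at p)"
  shows "frechet_derivative f (at p) v = (\<Sum>k\<in>UNIV. v $ k *\<^sub>R partial k f p)"
proof -
  have lin: "linear (frechet_derivative f (at p))"
    by (rule linear_frechet_derivative[OF assms])
  have "frechet_derivative f (at p) (\<Sum>k\<in>UNIV. v $ k *\<^sub>R axis k 1) = (\<Sum>k\<in>UNIV. v $ k *\<^sub>R partial k f p)"
    by (simp add: linear_sum[OF lin] linear_cmul[OF lin] partial_def)
  moreover have "(\<Sum>k\<in>UNIV. v $ k *\<^sub>R axis k 1) = v"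
    by (simp add: vec_eq_iff axis_def if_distrib cong: if_cong)
  ultimately show ?thesis by simp
qed

lemma partial_chart_change:
  fixes f :: "'a \<Rightarrow> 'b::real_normed_vector"
  assumes surf: "smooth_surface T A" and c: "c \<in> A" and d: "d \<in> A" and p: "p \<in> fst c" "p \<in> fst d"
    and f: "smooth_map A f"
  shows "partial i (local_rep c f) (snd c p) =
    (\<Sum>k\<in>UNIV. partial i (local_rep c (snd d)) (snd c p) $ k *\<^sub>R partial k (local_rep d f) (snd d p))"
proof -
  let ?V = "snd c ` (fst c \<inter> fst d)" and ?\<phi> = "local_rep c (snd d)" and ?F = "local_rep d f"
  have V: "open ?V" "snd c p \<in> ?V"
    using transition_domain_open[OF surf c d] p by auto
  note inj = chart_inj_on[OF surf c] chart_inj_on[OF surf d]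
  have \<phi>: "?\<phi> differentiable (at (snd c p))" "?\<phi> (snd c p) = snd d p"
    using smooth_on_differentiable[OF transition_smooth[OF surf c d] V] by (simp_all add: local_rep_chart inj p)
  have F: "?F differentiable (at (snd d p))"
    using f d p chart_image_open[OF surf d]
    by (intro smooth_on_differentiable[where S = "chart_image d"]) (auto simp: smooth_map_def chart_image_def)
  have "partial i (local_rep c f) (snd c p) = partial i (?F \<circ> ?\<phi>) (snd c p)"
  proof (rule partial_cong[symmetric, OF _ V])
    show "?F \<circ> ?\<phi> differentiable at (snd c p)"
      using \<phi> F by (intro differentiable_chain_at) auto
    show "(?F \<circ> ?\<phi>) q = local_rep c f q" if "q \<in> ?V" for q
      using that inj by (auto simp: local_rep_chart)
  qed
  also have "\<dots> = frechet_derivative ?F (at (snd d p)) (partial i ?\<phi> (snd c p))"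
    using frechet_derivative_compose[OF \<phi>(1), of ?F] F \<phi>(2) by (simp add: partial_def)
  finally show ?thesis
    by (simp add: frechet_derivative_eq_sum_partial[OF F])
qed

lemma pairing_congruence:
  fixes P :: "real^2^2"
  shows "(\<chi> i j. pairing G (\<Sum>k\<in>UNIV. P $ i $ k *\<^sub>R a k) (\<Sum>k\<in>UNIV. P $ j $ k *\<^sub>R b k))
    = P ** (\<chi> k l. pairing G (a k) (b l)) ** transpose P"
  by (simp add: vec_eq_iff sum_2 matrix_matrix_mult_def transpose_def
      bounded_bilinear.add_left[OF bounded_bilinear_pairing] bounded_bilinear.scaleR_left[OF bounded_bilinear_pairing]
      bounded_bilinear.add_right[OF bounded_bilinear_pairing] bounded_bilinear.scaleR_right[OF bounded_bilinear_pairing]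
      algebra_simps)

lemma congruence_scaleR:
  fixes P M :: "real^'n^'n"
  shows "P ** (a *\<^sub>R M) ** transpose P = a *\<^sub>R (P ** M ** transpose P)"
  by (simp add: matrix_scalar_ac scalar_matrix_assoc[symmetric])

lemma immersed_surface_in_half_space:
  assumes "smooth_surface T A" "immersed_surface A x" "c \<in> A" "u \<in> chart_image c"
  shows "local_rep c x u $ 3 > 0"
proof -
  obtain p where p: "p \<in> fst c" "u = snd c p"
    using assms(4) by (auto simp: chart_image_def)
  then have "x p \<in> half_space"
    using assms(2,3) unfolding immersed_surface_def by blast
  then show ?thesis
    by (simp add: p local_rep_chart chart_inj_on[OF assms(1,3)] half_space_def)
qed

lemma smooth_map_normal_gauss_map:
  assumes "smooth_surface T A" "immersed_surface A x" "smooth_map A N"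
  shows "smooth_map A (normal_gauss_map x N)"
  unfolding smooth_map_def
proof
  fix c assume c: "c \<in> A"
  have open_c: "open (chart_image c)"
    by (rule chart_image_open[OF assms(1) c])
  have pos: "local_rep c x u $ 3 \<noteq> 0" if "u \<in> chart_image c" for u
    using immersed_surface_in_half_space[OF assms(1,2) c that] by simp
  have "smooth_on (chart_image c) (\<lambda>u. (1 / local_rep c x u $ 3) *\<^sub>R local_rep c N u)"
    using assms(2,3) c
    by (intro smooth_on_intros open_c pos) (auto simp: immersed_surface_def smooth_map_def)
  then show "smooth_on (chart_image c) (local_rep c (normal_gauss_map x N))"
    by (simp add: local_rep_def normal_gauss_map_def comp_def)
qed

lemma space_like_euclidean_form:
  assumes "smooth_surface T A" "immersed_surface A x"
  shows "space_like (diag_form 1) A x"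
  unfolding space_like_def
proof (intro ballI allI impI)
  fix c u and v :: "real^2" assume c: "c \<in> A" and u: "u \<in> chart_image c" and "v \<noteq> 0"
  let ?X = "local_rep c x"
  have diff: "?X differentiable (at u)"
    using assms(2) c u chart_image_open[OF assms(1) c]
    by (auto simp: immersed_surface_def smooth_map_def intro: smooth_on_differentiable)
  have pos: "?X u $ 3 > 0"
    by (rule immersed_surface_in_half_space[OF assms c u])
  define w where "w = frechet_derivative ?X (at u) v"
  have "inj (frechet_derivative ?X (at u))"
    using assms(2) c u by (auto simp: immersed_surface_def)
  then have "w \<noteq> 0"
    using \<open>v \<noteq> 0\<close> linear_injective_0[OF linear_frechet_derivative[OF diff]] unfolding w_def by blast
  have "pairing (first_form (diag_form 1) x c u) v v = pairing (half_space_metric (diag_form 1) (?X u)) w w"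
    unfolding w_def frechet_derivative_eq_sum_partial[OF diff]
    unfolding pairing_def[of "first_form (diag_form 1) x c u"] unfolding first_form_def
    by (simp add: matrix_vector_mult_def inner_vec_def sum_2
      bounded_bilinear.add_left[OF bounded_bilinear_pairing] bounded_bilinear.scaleR_left[OF bounded_bilinear_pairing]
      bounded_bilinear.add_right[OF bounded_bilinear_pairing] bounded_bilinear.scaleR_right[OF bounded_bilinear_pairing]
      algebra_simps)
  also have "\<dots> = (w \<bullet> w) / (?X u $ 3)\<^sup>2"
    unfolding half_space_metric_def pairing_scaleR_form euclidean_form_eq_diag_form[symmetric]
    by (simp add: pairing_def)
  also have "\<dots> > 0"
    using pos \<open>w \<noteq> 0\<close> by simp
  finally show "pairing (first_form (diag_form 1) x c u) v v > 0" .
qed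

lemma half_space_patch_chart:
  assumes "e = 1 \<or> e = - 1" "smooth_surface T A" "immersed_surface A x" "space_like (diag_form e) A x"
    "unit_normal (diag_form e) e A x N" "c \<in> A"
  shows "half_space_patch c x N e"
proof
  note inj = chart_inj_on[OF assms(2,6)]
  show "e = 1 \<or> e = - 1" "open (chart_image c)" "smooth_on (chart_image c) (local_rep c x)"
    "smooth_on (chart_image c) (local_rep c N)"
    using assms chart_image_open[OF assms(2,6)] by (auto simp: immersed_surface_def unit_normal_def smooth_map_def)
  fix u assume u: "u \<in> chart_image c"
  then obtain p where p: "p \<in> fst c" "u = snd c p"
    by (auto simp: chart_image_def)
  show "local_rep c x u $ 3 > 0"
    by (rule immersed_surface_in_half_space[OF assms(2,3,6) u])
  show "pairing (half_space_metric (diag_form e) (local_rep c x u)) (local_rep c N u) (local_rep c N u) = e"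
    "pairing (half_space_metric (diag_form e) (local_rep c x u)) (local_rep c N u) (partial i (local_rep c x) u) = 0" for i
    using assms(5,6) p by (auto simp: local_rep_chart inj unit_normal_def)
  show "det (first_form (diag_form e) x c u) \<noteq> 0"
  proof
    assume "det (first_form (diag_form e) x c u) = 0"
    then have "rank (first_form (diag_form e) x c u) \<noteq> CARD(2)"
      unfolding det_eq_0_rank by simp
    then obtain v where "v \<noteq> 0" "first_form (diag_form e) x c u *v v = 0"
      using matrix_nonfull_linear_equations_eq by blast
    moreover from this(1) have "pairing (first_form (diag_form e) x c u) v v > 0"
      using assms(4,6) u by (auto simp: space_like_def)
    ultimately show False by (simp add: pairing_def)
  qed
qed

lemma forms_chart_change:
  assumes e: "e = 1 \<or> e = - 1" and surf: "smooth_surface T A" and x: "immersed_surface A x"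
    and sl: "space_like (diag_form e) A x" and N: "unit_normal (diag_form e) e A x N"
    and c: "c \<in> A" and d: "d \<in> A" and p: "p \<in> fst c" "p \<in> fst d"
  obtains P where
    "first_form (diag_form e) x c (snd c p) = P ** first_form (diag_form e) x d (snd d p) ** transpose P"
    "second_form (diag_form e) x N c (snd c p) = P ** second_form (diag_form e) x N d (snd d p) ** transpose P"
    "fourth_form (diag_form e) x N c (snd c p) = P ** fourth_form (diag_form e) x N d (snd d p) ** transpose P"
proof
  define P :: "real^2^2" where "P = (\<chi> i k. partial i (local_rep c (snd d)) (snd c p) $ k)"
  let ?\<eta> = "normal_gauss_map x N"
  have smooth: "smooth_map A x" "smooth_map A ?\<eta>"
    using x N smooth_map_normal_gauss_map[OF surf x] by (auto simp: immersed_surface_def unit_normal_def)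
  note change = partial_chart_change[OF surf c d p smooth(1)] partial_chart_change[OF surf c d p smooth(2)]
  have X: "partial i (local_rep c x) (snd c p) = (\<Sum>k\<in>UNIV. P $ i $ k *\<^sub>R partial k (local_rep d x) (snd d p))"
    and \<eta>: "partial i (local_rep c ?\<eta>) (snd c p) = (\<Sum>k\<in>UNIV. P $ i $ k *\<^sub>R partial k (local_rep d ?\<eta>) (snd d p))" for i
    by (simp_all add: P_def change)
  note inj = chart_inj_on[OF surf c] chart_inj_on[OF surf d]
  have val: "local_rep c f (snd c p) = f p" "local_rep d f (snd d p) = f p" for f :: "'a \<Rightarrow> real^3"
    using inj p by (simp_all add: local_rep_chart)
  have u: "snd c p \<in> chart_image c" "snd d p \<in> chart_image d"
    using p by (auto simp: chart_image_def)
  show I: "first_form (diag_form e) x c (snd c p) = P ** first_form (diag_form e) x d (snd d p) ** transpose P"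
    unfolding first_form_def val X by (rule pairing_congruence)
  show "fourth_form (diag_form e) x N c (snd c p) = P ** fourth_form (diag_form e) x N d (snd d p) ** transpose P"
    unfolding fourth_form_def \<eta> by (rule pairing_congruence)
  interpret C: half_space_patch c x N e
    by (rule half_space_patch_chart[OF e surf x sl N c])
  interpret D: half_space_patch d x N e
    by (rule half_space_patch_chart[OF e surf x sl N d])
  define M :: "real^2^2" where
    "M = (\<chi> i j. pairing (diag_form e) (partial i (local_rep d x) (snd d p)) (partial j (local_rep d ?\<eta>) (snd d p)))"
  have "(\<chi> i j. pairing (diag_form e) (partial i (local_rep c x) (snd c p)) (partial j (local_rep c ?\<eta>) (snd c p)))
      = P ** M ** transpose P"
    unfolding X \<eta> M_def by (rule pairing_congruence)
  then have M: "pairing (diag_form e) (partial i (local_rep c x) (snd c p)) (partial j (local_rep c ?\<eta>) (snd c p))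
      = (P ** M ** transpose P) $ i $ j" for i j
    by (auto simp: vec_eq_iff)
  have IID: "second_form (diag_form e) x N d (snd d p) = e *\<^sub>R (?\<eta> p $ 3 *\<^sub>R first_form (diag_form e) x d (snd d p) - (1 / x p $ 3) *\<^sub>R M)"
    using D.second_form_gauss[OF u(2)] by (simp add: vec_eq_iff val D.z_def M_def)
  have IIC: "second_form (diag_form e) x N c (snd c p)
      = e *\<^sub>R (?\<eta> p $ 3 *\<^sub>R first_form (diag_form e) x c (snd c p) - (1 / x p $ 3) *\<^sub>R (P ** M ** transpose P))"
    using C.second_form_gauss[OF u(1)] by (simp add: vec_eq_iff val C.z_def M)
  show "second_form (diag_form e) x N c (snd c p) = P ** second_form (diag_form e) x N d (snd d p) ** transpose P"
    unfolding IIC IID I by (simp add: vec_eq_iff matrix_matrix_mult_def sum_2 algebra_simps)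
qed

lemma conformal_iff_curvature:
  assumes e: "e = 1 \<or> e = - 1" and surf: "smooth_surface T A" and x: "immersed_surface A x"
    and sl: "space_like (diag_form e) A x" and N: "unit_normal (diag_form e) e A x N"
    and no_umbilics: "\<forall>p\<in>topspace T. \<not> umbilic (diag_form e) A x N p"
  shows "conformal_normal_gauss_map (diag_form e) A x N \<longleftrightarrow>
    (\<forall>c\<in>A. \<forall>p\<in>fst c. gauss_curvature (diag_form e) x c p = - e + e * (normal_gauss_map x N p $ 3)\<^sup>2)"
    (is "?conf \<longleftrightarrow> ?curv")
proof -
  let ?I = "\<lambda>c p. first_form (diag_form e) x c (snd c p)"
  let ?II = "\<lambda>c p. second_form (diag_form e) x N c (snd c p)"
  let ?IV = "\<lambda>c p. fourth_form (diag_form e) x N c (snd c p)"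
  let ?r = "\<lambda>c p. conformal_factor e x N c (snd c p)"
  let ?k = "\<lambda>c p. e * (gauss_curvature (diag_form e) x c p - (- e + e * (normal_gauss_map x N p $ 3)\<^sup>2))"
  note patch = half_space_patch_chart[OF e surf x sl N]
  note change = forms_chart_change[OF e surf x sl N]
  have IV: "?IV c p = ?r c p *\<^sub>R ?II c p - ?k c p *\<^sub>R ?I c p" if "c \<in> A" "p \<in> fst c" for c p
    using half_space_patch.fourth_form_eq[OF patch[OF that(1)], of "snd c p"] that
    by (simp add: chart_image_def local_rep_chart chart_inj_on[OF surf] gauss_curvature_def)
  have I: "?I c p \<noteq> 0" if "c \<in> A" "p \<in> fst c" for c p
    using half_space_patch.det_first_form[OF patch[OF that(1)], of "snd c p"] that
    by (auto simp: chart_image_def det_2)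
  have II: "?II c p \<noteq> a *\<^sub>R ?I c p" if "c \<in> A" "p \<in> fst c" for c p a
  proof
    assume a: "?II c p = a *\<^sub>R ?I c p"
    have "?II d p = a *\<^sub>R ?I d p" if "d \<in> A" "p \<in> fst d" for d
    proof -
      from change[OF \<open>d \<in> A\<close> \<open>c \<in> A\<close> \<open>p \<in> fst d\<close> \<open>p \<in> fst c\<close>] obtain P
        where "?I d p = P ** ?I c p ** transpose P" "?II d p = P ** ?II c p ** transpose P" .
      then show ?thesis
        by (simp only: a congruence_scaleR)
    qed
    then have "umbilic (diag_form e) A x N p"
      by (auto simp: umbilic_def)
    moreover have "p \<in> topspace T"
      using openin_subset[OF chart_openin[OF surf]] that by blast
    ultimately show False
      using no_umbilics by blast
  qed
  show ?thesis
  proof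
    assume ?conf
    then obtain \<rho> where \<rho>: "\<And>c p. c \<in> A \<Longrightarrow> p \<in> fst c \<Longrightarrow> ?IV c p = \<rho> p *\<^sub>R ?II c p"
      by (auto simp: conformal_normal_gauss_map_def)
    have "?k c p = 0" if "c \<in> A" "p \<in> fst c" for c p
    proof -
      have eq: "(?r c p - \<rho> p) *\<^sub>R ?II c p = ?k c p *\<^sub>R ?I c p"
        using IV[OF that] \<rho>[OF that] by (simp add: algebra_simps)
      have "?r c p = \<rho> p"
      proof (rule ccontr)
        assume "?r c p \<noteq> \<rho> p"
        then have "?II c p = (1 / (?r c p - \<rho> p)) *\<^sub>R ((?r c p - \<rho> p) *\<^sub>R ?II c p)"
          by simp
        also have "\<dots> = (?k c p / (?r c p - \<rho> p)) *\<^sub>R ?I c p"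
          unfolding eq by simp
        finally show False
          using II[OF that] by blast
      qed
      with eq I[OF that] show ?thesis by simp
    qed
    then show ?curv
      using e by auto
  next
    assume ?curv
    then have IV': "?IV c p = ?r c p *\<^sub>R ?II c p" if "c \<in> A" "p \<in> fst c" for c p
      using IV[OF that] that by simp
    have indep: "?r c p = ?r d p" if "c \<in> A" "d \<in> A" "p \<in> fst c" "p \<in> fst d" for c d p
    proof -
      have "?IV c p = ?r d p *\<^sub>R ?II c p"
      proof -
        from change[OF that] obtain P
          where "?II c p = P ** ?II d p ** transpose P" "?IV c p = P ** ?IV d p ** transpose P" .
        then show ?thesis
          by (simp only: IV'[OF that(2,4)] congruence_scaleR)
      qed
      moreover have "?II c p \<noteq> 0"
        using II[OF that(1,3), of 0] by simp
      ultimately show ?thesis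
        using IV'[OF that(1,3)] by simp
    qed
    define \<rho> where "\<rho> p = ?r (SOME c. c \<in> A \<and> p \<in> fst c) p" for p
    have \<rho>: "\<rho> p = ?r c p" if "c \<in> A" "p \<in> fst c" for c p
    proof -
      have "(SOME c. c \<in> A \<and> p \<in> fst c) \<in> A \<and> p \<in> fst (SOME c. c \<in> A \<and> p \<in> fst c)"
        by (rule someI[of _ c]) (use that in blast)
      then show ?thesis
        unfolding \<rho>_def using indep that by blast
    qed
    have "smooth_map A \<rho>"
      unfolding smooth_map_def
    proof
      fix c assume c: "c \<in> A"
      show "smooth_on (chart_image c) (local_rep c \<rho>)"
        by (rule smooth_on_cong[OF half_space_patch.smooth_conformal_factor[OF patch[OF c]] chart_image_open[OF surf c]])
          (auto simp: chart_image_def local_rep_chart chart_inj_on[OF surf c] \<rho>[OF c])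
    qed
    moreover have "?IV c p = \<rho> p *\<^sub>R ?II c p" if "c \<in> A" "p \<in> fst c" for c p
      using IV'[OF that] \<rho>[OF that] by simp
    ultimately show ?conf
      unfolding conformal_normal_gauss_map_def by blast
  qed
qed

theorem theorem3p3:
  fixes T :: "'a topology" and A :: "'a chart set" and x N :: "'a \<Rightarrow> real^3"
  assumes "smooth_surface T A"
    and "immersed_surface A x"
  shows
    "(unit_normal euclidean_form 1 A x N \<and>
      (\<forall>p\<in>topspace T. \<not> umbilic euclidean_form A x N p) \<longrightarrow>
        (conformal_normal_gauss_map euclidean_form A x N \<longleftrightarrow>
          (\<forall>c\<in>A. \<forall>p\<in>fst c.
             gauss_curvature euclidean_form x c p = - 1 + (normal_gauss_map x N p $ 3)\<^sup>2))) \<and>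
     (space_like minkowski_form A x \<and> unit_normal minkowski_form (- 1) A x N \<and>
      (\<forall>p\<in>topspace T. \<not> umbilic minkowski_form A x N p) \<longrightarrow>
        (conformal_normal_gauss_map minkowski_form A x N \<longleftrightarrow>
          (\<forall>c\<in>A. \<forall>p\<in>fst c.
             gauss_curvature minkowski_form x c p = 1 - (normal_gauss_map x N p $ 3)\<^sup>2)))"
  using conformal_iff_curvature[of 1, OF _ assms space_like_euclidean_form[OF assms]]
    conformal_iff_curvature[of "- 1", OF _ assms]
  by (simp add: euclidean_form_eq_diag_form minkowski_form_eq_diag_form)

end
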